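(* For a topological group $X$ of precompact exponent the following conditions are equivalent: (1) $X$ is $\mathsf{i}{:}\mathsf{TS}$-closed; (2) $X$ is $\mathsf{i}{:}\mathsf{TG}$-closed.
   Context: All topological groups and topological semigroups are assumed Hausdorff; a topological semigroup has jointly continuous multiplication. A topological group $X$ has precompact exponent if for some $n\in\mathbb N$ (with $n\ge1$) the set $nX=\{x^n:x\in X\}$ is precompact in $X$, i.e. for every neighborhood $U\subset X$ of the unit there is a finite $F\subset X$ with $nX\subset FU\cap UF$. $X$ is $\mathsf{i}{:}\mathsf{TS}$-closed (resp. $\mathsf{i}{:}\mathsf{TG}$-closed) if for every injective continuous homomorphism $f:X\to Y$ to a Hausdorff topological semigroup (resp. Hausdorff topological group) $Y$ the image $f(X)$ is closed in $Y$. *)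

theory Defs
  imports "HOL-Algebra.Coset" "HOL-Analysis.T1_Spaces" "HOL-Analysis.Product_Topology"
begin

(* Carrier-based structures. HOL-Algebra has no record for bare semigroups, so a semigroup is
   carried by a monoid record of which only the carrier and the multiplication are used; the
   unit field is left unconstrained (hom does not mention it either). *)

locale topological_semigroup =
  fixes S :: "('a, 'm) monoid_scheme" (structure) and T :: "'a topology"
  assumes m_closed: "\<lbrakk>x \<in> carrier S; y \<in> carrier S\<rbrakk> \<Longrightarrow> x \<otimes> y \<in> carrier S"
    and m_assoc: "\<lbrakk>x \<in> carrier S; y \<in> carrier S; z \<in> carrier S\<rbrakk>
      \<Longrightarrow> (x \<otimes> y) \<otimes> z = x \<otimes> (y \<otimes> z)"
    and topspace_eq: "topspace T = carrier S"
    and Hausdorff: "Hausdorff_space T"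
    and continuous_mult: "continuous_map (prod_topology T T) T (\<lambda>(x, y). x \<otimes> y)"

locale topological_group = group G
  for G :: "('a, 'm) monoid_scheme" (structure) and T :: "'a topology" +
  assumes topspace_eq: "topspace T = carrier G"
    and Hausdorff: "Hausdorff_space T"
    and continuous_mult: "continuous_map (prod_topology T T) T (\<lambda>(x, y). x \<otimes> y)"
    and continuous_inv: "continuous_map T T (\<lambda>x. inv x)"

(* A neighborhood of the unit is a set having the unit in its interior; it need not be open. *)
definition precompact_in ::
  "('a, 'm) monoid_scheme \<Rightarrow> 'a topology \<Rightarrow> 'a set \<Rightarrow> bool" where
  "precompact_in G T A \<longleftrightarrow>
     (\<forall>U \<subseteq> carrier G. \<one>\<^bsub>G\<^esub> \<in> T interior_of U \<longrightarrow>
        (\<exists>F \<subseteq> carrier G. finite F \<and> A \<subseteq> (F <#>\<^bsub>G\<^esub> U) \<inter> (U <#>\<^bsub>G\<^esub> F)))"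

definition precompact_exponent :: "('a, 'm) monoid_scheme \<Rightarrow> 'a topology \<Rightarrow> bool" where
  "precompact_exponent G T \<longleftrightarrow>
     (\<exists>n::nat. n \<ge> 1 \<and> precompact_in G T ((\<lambda>x. x [^]\<^bsub>G\<^esub> n) ` carrier G))"

(* HOL cannot quantify over types inside a formula, so the target Y ranges over all structures
   whose carrier is a subset of the type 'b passed as the itself argument. The closedness
   properties of the mathematical text are these properties for all types 'b. An equivalence
   proved for an arbitrary 'b therefore yields the equivalence of the unrestricted properties.

   No size condition on 'b is needed. If y lies in the closure of f(X) but not in f(X), then
   f(X) is not closed in the subsemigroup (subgroup) generated by f(X) and y either. Such an X is
   infinite, as finite sets are closed in Hausdorff spaces, so that substructure is equipotent
   to X. Hence any 'b into which X injects detects every failure of closedness, and for any other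
   'b both properties hold vacuously. *)

definition iTS_closed ::
  "'b itself \<Rightarrow> ('a, 'm) monoid_scheme \<Rightarrow> 'a topology \<Rightarrow> bool" where
  "iTS_closed (_ :: 'b itself) X T \<longleftrightarrow>
     (\<forall>(Y :: 'b monoid) S f.
        topological_semigroup Y S \<and> f \<in> hom X Y \<and> inj_on f (carrier X) \<and> continuous_map T S f
        \<longrightarrow> closedin S (f ` carrier X))"

definition iTG_closed ::
  "'b itself \<Rightarrow> ('a, 'm) monoid_scheme \<Rightarrow> 'a topology \<Rightarrow> bool" where
  "iTG_closed (_ :: 'b itself) X T \<longleftrightarrow>
     (\<forall>(Y :: 'b monoid) S f.
        topological_group Y S \<and> f \<in> hom X Y \<and> inj_on f (carrier X) \<and> continuous_map T S f
        \<longrightarrow> closedin S (f ` carrier X))"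

end

theory Submission
  imports
    Defs
    "HOL-Algebra.Free_Abelian_Groups"
    "HOL-Algebra.Weak_Morphisms"
    "HOL-Analysis.Abstract_Topological_Spaces"
begin

text \<open>
  Topological groups are topological semigroups, so only one implication needs an argument. Let \<open>X\<close>
  be closed in every Hausdorff topological group that it maps to by a continuous injective
  homomorphism, let the set of \<open>n\<close>-th powers in \<open>X\<close> be precompact, and let \<open>f : X \<rightarrow> Y\<close> be a continuous
  injective homomorphism to a Hausdorff topological semigroup. The aim is to see that the closure
  \<open>Z\<close> of \<open>f(X)\<close> is a topological group, for then \<open>f(X)\<close> is closed in \<open>Z\<close> and hence in \<open>Y\<close>.

  The obstacle is inversion, which \<open>Y\<close> lacks and which need not even be continuous on \<open>f(X)\<close>. The
  exponent provides it through \<open>x\<inverse> = (x\<^sup>n)\<inverse> x\<^sup>n\<^sup>-\<^sup>1\<close>: it is enough to invert \<open>n\<close>-th powers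
  continuously. Suppose that these lie in a compact subset \<open>K\<close> of \<open>X\<close>. Then \<open>f\<close> restricts to a
  homeomorphism from \<open>K\<close> to \<open>f(K)\<close>, the \<open>n\<close>-th powers of elements of \<open>Z\<close> stay in the closed set \<open>f(K)\<close>,
  and inversion transported from \<open>K\<close> to \<open>f(K)\<close> makes \<open>Z\<close> a topological group. This is
  \<open>closed_image_if_powers_in_compact\<close>.

  For \<open>K\<close> one takes the closure of the set of \<open>n\<close>-th powers. It is precompact, so each ultrafilter on
  it is Cauchy for the two-sided uniformity, and it is compact if all of these converge
  (\<open>compactin_closure_of_precompact\<close>). Convergence is the completeness of \<open>X\<close>, shown in
  \<open>Cauchy_net_converges\<close>: a Cauchy net without a limit would yield a Hausdorff group generated by \<open>X\<close>
  and a limit of the net, in which \<open>X\<close> is not closed. The carrier of that group has to be a subset of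
  the same type \<open>'b\<close> as that of \<open>Y\<close>. It can be, because it has no more elements than \<open>X\<close> when \<open>X\<close> is
  infinite, and \<open>X\<close> injects into \<open>'b\<close> by \<open>f\<close>. When \<open>X\<close> is finite, so is \<open>f(X)\<close>, and finite subsets of
  Hausdorff spaces are closed.
\<close>

section \<open>Group topologies from a base of unit neighbourhoods\<close>

text \<open>The members of the base are not required to be open. The base used for the extension of a
  group by a limit consists of conditions of the form "eventually in \<open>U\<close>", and these do not describe
  open sets even when \<open>U\<close> is open, because a limit may lie on the boundary of \<open>U\<close>.\<close>

locale unit_nbhd_base = group G for G (structure) +
  fixes \<N> :: "'a set set"
  assumes ex_nbhd: "\<N> \<noteq> {}"
    and nbhd_subset: "U \<in> \<N> \<Longrightarrow> U \<subseteq> carrier G"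
    and one_in_nbhd: "U \<in> \<N> \<Longrightarrow> \<one> \<in> U"
    and nbhd_Int: "\<lbrakk>U \<in> \<N>; V \<in> \<N>\<rbrakk> \<Longrightarrow> \<exists>W\<in>\<N>. W \<subseteq> U \<inter> V"
    and nbhd_mult: "U \<in> \<N> \<Longrightarrow> \<exists>V\<in>\<N>. \<forall>x\<in>V. \<forall>y\<in>V. x \<otimes> y \<in> U"
    and nbhd_inv: "U \<in> \<N> \<Longrightarrow> \<exists>V\<in>\<N>. \<forall>x\<in>V. inv x \<in> U"
    and nbhd_conj: "\<lbrakk>U \<in> \<N>; g \<in> carrier G\<rbrakk> \<Longrightarrow> \<exists>V\<in>\<N>. \<forall>x\<in>V. inv g \<otimes> x \<otimes> g \<in> U"
begin

definition group_topology :: "'a topology" where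
  "group_topology = topology (\<lambda>D. D \<subseteq> carrier G \<and> (\<forall>g\<in>D. \<exists>U\<in>\<N>. \<forall>x\<in>U. g \<otimes> x \<in> D))"

lemma openin_group_topology:
  "openin group_topology D \<longleftrightarrow> D \<subseteq> carrier G \<and> (\<forall>g\<in>D. \<exists>U\<in>\<N>. \<forall>x\<in>U. g \<otimes> x \<in> D)"
proof -
  have "istopology (\<lambda>D. D \<subseteq> carrier G \<and> (\<forall>g\<in>D. \<exists>U\<in>\<N>. \<forall>x\<in>U. g \<otimes> x \<in> D))"
    unfolding istopology_def
  proof (intro conjI allI impI; (elim conjE)?)
    fix S T
    assume S: "S \<subseteq> carrier G" "\<forall>g\<in>S. \<exists>U\<in>\<N>. \<forall>x\<in>U. g \<otimes> x \<in> S"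
      and T: "T \<subseteq> carrier G" "\<forall>g\<in>T. \<exists>U\<in>\<N>. \<forall>x\<in>U. g \<otimes> x \<in> T"
    show "S \<inter> T \<subseteq> carrier G" using S by auto
    show "\<forall>g\<in>S \<inter> T. \<exists>U\<in>\<N>. \<forall>x\<in>U. g \<otimes> x \<in> S \<inter> T"
    proof
      fix g assume "g \<in> S \<inter> T"
      then obtain U V where "U \<in> \<N>" "\<forall>x\<in>U. g \<otimes> x \<in> S" "V \<in> \<N>" "\<forall>x\<in>V. g \<otimes> x \<in> T"
        using S T by blast
      then show "\<exists>U\<in>\<N>. \<forall>x\<in>U. g \<otimes> x \<in> S \<inter> T"
        using nbhd_Int[of U V] by blast
    qed
  next
    fix \<K> assume K: "\<forall>K\<in>\<K>. K \<subseteq> carrier G \<and> (\<forall>g\<in>K. \<exists>U\<in>\<N>. \<forall>x\<in>U. g \<otimes> x \<in> K)"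
    then show "\<Union> \<K> \<subseteq> carrier G" by auto
    show "\<forall>g\<in>\<Union> \<K>. \<exists>U\<in>\<N>. \<forall>x\<in>U. g \<otimes> x \<in> \<Union> \<K>"
      using K by (meson UnionE UnionI)
  qed
  then show ?thesis
    unfolding group_topology_def by (simp add: topology_inverse')
qed

lemma topspace_group_topology: "topspace group_topology = carrier G"
proof -
  have "openin group_topology (carrier G)"
    unfolding openin_group_topology using ex_nbhd nbhd_subset by blast
  then show ?thesis
    by (metis openin_group_topology openin_subset openin_topspace subset_antisym)
qed

text \<open>A translate \<open>gU\<close> need not be open, since the members of the base need not be; it does
  contain the open set of all \<open>h\<close> for which some \<open>hV\<close> is contained in \<open>gU\<close>.\<close>

lemma translate_contains_open:
  assumes "g \<in> carrier G" "U \<in> \<N>"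
  obtains D where "openin group_topology D" "g \<in> D" "\<And>h. h \<in> D \<Longrightarrow> \<exists>x\<in>U. h = g \<otimes> x"
proof
  let ?D = "{h \<in> carrier G. \<exists>V\<in>\<N>. \<forall>x\<in>V. h \<otimes> x \<in> (\<lambda>y. g \<otimes> y) ` U}"
  show "openin group_topology ?D"
    unfolding openin_group_topology
  proof (intro conjI ballI)
    fix h assume "h \<in> ?D"
    then obtain V where h: "h \<in> carrier G" and V: "V \<in> \<N>" "\<forall>x\<in>V. h \<otimes> x \<in> (\<lambda>y. g \<otimes> y) ` U"
      by blast
    obtain W where W: "W \<in> \<N>" "\<forall>x\<in>W. \<forall>y\<in>W. x \<otimes> y \<in> V"
      using nbhd_mult V(1) by blast
    have "h \<otimes> x \<in> ?D" if "x \<in> W" for x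
    proof -
      have "h \<otimes> x \<otimes> y \<in> (\<lambda>y. g \<otimes> y) ` U" if "y \<in> W" for y
        using V W h \<open>x \<in> W\<close> \<open>y \<in> W\<close> nbhd_subset[OF W(1)] by (simp add: m_assoc subset_iff)
      then have "\<exists>V\<in>\<N>. \<forall>y\<in>V. h \<otimes> x \<otimes> y \<in> (\<lambda>y. g \<otimes> y) ` U"
        using W(1) by (intro bexI[of _ W]) auto
      moreover have "h \<otimes> x \<in> carrier G"
        using h that nbhd_subset[OF W(1)] by auto
      ultimately show ?thesis by simp
    qed
    then show "\<exists>W\<in>\<N>. \<forall>x\<in>W. h \<otimes> x \<in> ?D" using W(1) by (intro bexI[of _ W]) auto
  qed auto
  show "g \<in> ?D" using assms by (auto intro!: bexI[of _ U])
  show "\<exists>x\<in>U. h = g \<otimes> x" if "h \<in> ?D" for h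
  proof -
    obtain V where "h \<in> carrier G" "V \<in> \<N>" "\<forall>x\<in>V. h \<otimes> x \<in> (\<lambda>y. g \<otimes> y) ` U"
      using \<open>h \<in> ?D\<close> by blast
    then have "h \<otimes> \<one> \<in> (\<lambda>y. g \<otimes> y) ` U" using one_in_nbhd by blast
    then show ?thesis using \<open>h \<in> carrier G\<close> by auto
  qed
qed

text \<open>From \<open>(gx)(hy) = gh \<cdot> (h\<inverse>xh) y\<close>, multiplication is continuous as soon as conjugation by a fixed
  element is continuous at the unit.\<close>

lemma continuous_mult_group_topology:
  "continuous_map (prod_topology group_topology group_topology) group_topology (\<lambda>(x, y). x \<otimes> y)"
  unfolding continuous_map_def
proof (intro conjI allI impI)
  show "(\<lambda>(x, y). x \<otimes> y) \<in> topspace (prod_topology group_topology group_topology) \<rightarrow> topspace group_topology"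
    by (auto simp: topspace_group_topology)
  fix D assume D: "openin group_topology D"
  show "openin (prod_topology group_topology group_topology)
          {p \<in> topspace (prod_topology group_topology group_topology). (case p of (x, y) \<Rightarrow> x \<otimes> y) \<in> D}"
    unfolding openin_prod_topology_alt
  proof (intro allI impI)
    fix g h
    assume "(g, h) \<in> {p \<in> topspace (prod_topology group_topology group_topology).
                        (case p of (x, y) \<Rightarrow> x \<otimes> y) \<in> D}"
    then have gh: "g \<in> carrier G" "h \<in> carrier G" "g \<otimes> h \<in> D"
      by (auto simp: topspace_group_topology)
    then obtain U where U: "U \<in> \<N>" "\<forall>x\<in>U. g \<otimes> h \<otimes> x \<in> D"
      using D unfolding openin_group_topology by blast
    obtain V where V: "V \<in> \<N>" "\<forall>x\<in>V. \<forall>y\<in>V. x \<otimes> y \<in> U" using nbhd_mult U(1) by blast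
    obtain W where W: "W \<in> \<N>" "\<forall>x\<in>W. inv h \<otimes> x \<otimes> h \<in> V" using nbhd_conj V(1) gh by blast
    obtain A where A: "openin group_topology A" "g \<in> A" "\<And>a. a \<in> A \<Longrightarrow> \<exists>x\<in>W. a = g \<otimes> x"
      using translate_contains_open[OF gh(1) W(1)] by blast
    obtain B where B: "openin group_topology B" "h \<in> B" "\<And>a. a \<in> B \<Longrightarrow> \<exists>x\<in>V. a = h \<otimes> x"
      using translate_contains_open[OF gh(2) V(1)] by blast
    have "a \<otimes> b \<in> D" if "a \<in> A" "b \<in> B" for a b
    proof -
      obtain x y where x: "x \<in> W" "a = g \<otimes> x" and y: "y \<in> V" "b = h \<otimes> y"
        using A(3)[OF \<open>a \<in> A\<close>] B(3)[OF \<open>b \<in> B\<close>] by blast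
      have c: "x \<in> carrier G" "y \<in> carrier G" using x y V W nbhd_subset by blast+
      have "a \<otimes> b = g \<otimes> h \<otimes> ((inv h \<otimes> x \<otimes> h) \<otimes> y)"
        using c gh x y by (simp add: m_assoc inv_solve_left)
          (simp add: m_assoc[symmetric])
      then show ?thesis using U V W x y by auto
    qed
    then show "\<exists>A B. openin group_topology A \<and> openin group_topology B \<and> g \<in> A \<and> h \<in> B \<and>
        A \<times> B \<subseteq> {p \<in> topspace (prod_topology group_topology group_topology).
                        (case p of (x, y) \<Rightarrow> x \<otimes> y) \<in> D}"
      using A B openin_subset[OF A(1)] openin_subset[OF B(1)]
      by (intro exI[of _ A] exI[of _ B]) (auto simp: subset_iff)
  qed
qed

text \<open>Here the identity is \<open>(gx)\<inverse> = g\<inverse> \<cdot> (g x\<inverse> g\<inverse>)\<close>.\<close>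

lemma continuous_inv_group_topology:
  "continuous_map group_topology group_topology (\<lambda>x. inv x)"
  unfolding continuous_map_def
proof (intro conjI allI impI)
  show "(\<lambda>x. inv x) \<in> topspace group_topology \<rightarrow> topspace group_topology"
    by (auto simp: topspace_group_topology)
  fix D assume D: "openin group_topology D"
  show "openin group_topology {x \<in> topspace group_topology. inv x \<in> D}"
    unfolding openin_group_topology topspace_group_topology
  proof (intro conjI ballI)
    fix g assume "g \<in> {x \<in> carrier G. inv x \<in> D}"
    then have g: "g \<in> carrier G" "inv g \<in> D" by auto
    then obtain U where U: "U \<in> \<N>" "\<forall>x\<in>U. inv g \<otimes> x \<in> D"
      using D unfolding openin_group_topology by blast
    obtain V where V: "V \<in> \<N>" "\<forall>x\<in>V. inv (inv g) \<otimes> x \<otimes> inv g \<in> U"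
      using nbhd_conj[OF U(1), of "inv g"] g by auto
    obtain W where W: "W \<in> \<N>" "\<forall>x\<in>W. inv x \<in> V" using nbhd_inv V(1) by blast
    have "inv (g \<otimes> x) \<in> D" if "x \<in> W" for x
    proof -
      have x: "x \<in> carrier G" using that W nbhd_subset by blast
      have "inv (g \<otimes> x) = inv g \<otimes> (g \<otimes> inv x \<otimes> inv g)"
        using g x by (simp add: inv_mult_group m_assoc[symmetric])
      then show ?thesis using U V W that g by auto
    qed
    then show "\<exists>U\<in>\<N>. \<forall>x\<in>U. g \<otimes> x \<in> {x \<in> carrier G. inv x \<in> D}"
      using W(1) g nbhd_subset[OF W(1)] by (intro bexI[of _ W]) auto
  qed auto
qed

lemma Hausdorff_group_topology:
  assumes "\<Inter>\<N> \<subseteq> {\<one>}"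
  shows "Hausdorff_space group_topology"
  unfolding Hausdorff_space_def topspace_group_topology
proof (intro allI impI; elim conjE)
  fix g h assume gh: "g \<in> carrier G" "h \<in> carrier G" "g \<noteq> h"
  then have "inv g \<otimes> h \<noteq> \<one>"
    by (metis inv_closed inv_equality inv_inv)
  then obtain U where U: "U \<in> \<N>" "inv g \<otimes> h \<notin> U" using assms by blast
  obtain V where V: "V \<in> \<N>" "\<forall>x\<in>V. \<forall>y\<in>V. x \<otimes> y \<in> U" using nbhd_mult U(1) by blast
  obtain V' where V': "V' \<in> \<N>" "\<forall>x\<in>V'. inv x \<in> V" using nbhd_inv V(1) by blast
  obtain A where A: "openin group_topology A" "g \<in> A" "\<And>a. a \<in> A \<Longrightarrow> \<exists>x\<in>V. a = g \<otimes> x"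
    using translate_contains_open[OF gh(1) V(1)] by blast
  obtain B where B: "openin group_topology B" "h \<in> B" "\<And>a. a \<in> B \<Longrightarrow> \<exists>x\<in>V'. a = h \<otimes> x"
    using translate_contains_open[OF gh(2) V'(1)] by blast
  have "a \<noteq> b" if "a \<in> A" "b \<in> B" for a b
  proof
    assume "a = b"
    obtain x y where x: "x \<in> V" "a = g \<otimes> x" and y: "y \<in> V'" "b = h \<otimes> y"
      using A(3)[OF \<open>a \<in> A\<close>] B(3)[OF \<open>b \<in> B\<close>] by blast
    have c: "x \<in> carrier G" "y \<in> carrier G" using x y V V' nbhd_subset by blast+
    have "h = g \<otimes> x \<otimes> inv y"
      using c gh x y \<open>a = b\<close> by (simp add: inv_solve_right)
    then have "inv g \<otimes> h = x \<otimes> inv y"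
      using c gh by (simp add: m_assoc) (simp add: m_assoc[symmetric])
    then show False using U V V' x y by auto
  qed
  then show "\<exists>A B. openin group_topology A \<and> openin group_topology B \<and> g \<in> A \<and> h \<in> B \<and> disjnt A B"
    using A B unfolding disjnt_iff by blast
qed

lemma topological_group_group_topology:
  assumes "\<Inter>\<N> \<subseteq> {\<one>}"
  shows "topological_group G group_topology"
  using Hausdorff_group_topology[OF assms] topspace_group_topology
    continuous_mult_group_topology continuous_inv_group_topology
  by unfold_locales

lemma nbhd_inv_mult_mult:
  assumes "U \<in> \<N>"
  obtains V where "V \<in> \<N>" "\<And>x y z. \<lbrakk>x \<in> V; y \<in> V; z \<in> V\<rbrakk> \<Longrightarrow> inv x \<otimes> y \<otimes> z \<in> U"
proof -
  obtain A where A: "A \<in> \<N>" "\<forall>x\<in>A. \<forall>y\<in>A. x \<otimes> y \<in> U" using nbhd_mult assms by blast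
  obtain B where B: "B \<in> \<N>" "\<forall>x\<in>B. \<forall>y\<in>B. x \<otimes> y \<in> A" using nbhd_mult A(1) by blast
  obtain C where C: "C \<in> \<N>" "\<forall>x\<in>C. inv x \<in> B" using nbhd_inv B(1) by blast
  obtain W where W: "W \<in> \<N>" "W \<subseteq> A \<inter> B" using nbhd_Int A(1) B(1) by blast
  obtain V where V: "V \<in> \<N>" "V \<subseteq> W \<inter> C" using nbhd_Int W(1) C(1) by blast
  have "inv x \<otimes> y \<otimes> z \<in> U" if "x \<in> V" "y \<in> V" "z \<in> V" for x y z
  proof -
    have "inv x \<in> B" "y \<in> B" "z \<in> A" using that V(2) W(2) C(2) by auto
    then show ?thesis using A(2) B(2) by simp
  qed
  with V(1) show thesis by (rule that)
qed

end

text \<open>Every element of the generated subgroup is the value of a word in the generators and their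
  inverses, and there are only as many words over an infinite alphabet as there are letters.\<close>

lemma (in group) generate_lepoll_infinite:
  assumes "A \<subseteq> carrier G" "infinite A"
  shows "generate G A \<lesssim> A"
proof -
  let ?L = "A \<union> (\<lambda>a. inv a) ` A"
  have L: "?L \<subseteq> carrier G" using assms by auto
  have closed: "foldr (\<otimes>) xs \<one> \<in> carrier G" if "xs \<in> lists ?L" for xs
    using that L by (induction xs) auto
  have append: "foldr (\<otimes>) (xs @ ys) \<one> = foldr (\<otimes>) xs \<one> \<otimes> foldr (\<otimes>) ys \<one>"
    if "xs \<in> lists ?L" "ys \<in> lists ?L" for xs ys
    using that
  proof (induction xs)
    case (Cons x xs)
    then have "x \<in> carrier G" "xs \<in> lists ?L" using L by auto
    then show ?case using Cons closed by (simp add: m_assoc)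
  qed (simp add: closed)
  have "generate G A \<subseteq> (\<lambda>xs. foldr (\<otimes>) xs \<one>) ` lists ?L"
  proof
    fix g assume "g \<in> generate G A"
    then show "g \<in> (\<lambda>xs. foldr (\<otimes>) xs \<one>) ` lists ?L"
    proof induction
      case one
      show ?case by (rule image_eqI[of _ _ "[]"]) auto
    next
      case (incl h)
      then show ?case using assms by (intro image_eqI[of _ _ "[h]"]) auto
    next
      case (inv h)
      then show ?case using assms by (intro image_eqI[of _ _ "[inv h]"]) auto
    next
      case (eng h1 h2)
      then obtain xs ys where "xs \<in> lists ?L" "h1 = foldr (\<otimes>) xs \<one>" "ys \<in> lists ?L" "h2 = foldr (\<otimes>) ys \<one>"
        by blast
      then show ?case using append by (intro image_eqI[of _ _ "xs @ ys"]) auto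
    qed
  qed
  then have "generate G A \<lesssim> lists ?L"
    using lepoll_trans[OF subset_imp_lepoll image_lepoll] by blast
  also have "lists ?L \<lesssim> ?L"
    using card_of_lists_infinite[of ?L] assms(2)
    by (metis card_of_ordLeq infinite_Un lepoll_def ordIso_imp_ordLeq)
  also have "?L \<lesssim> A"
  proof -
    have "|?L| \<le>o |A|"
      using assms(2) by (intro card_of_Un_ordLeq_infinite) (auto simp: card_of_image)
    then show ?thesis by (simp add: card_of_ordLeq[symmetric] lepoll_def)
  qed
  finally show ?thesis .
qed

section \<open>Hausdorff quotients and groups of Cauchy nets\<close>

context unit_nbhd_base
begin

lemma nbhd_base_image:
  assumes H: "group H" and q: "q \<in> hom G H" and onto: "q ` carrier G = carrier H"
  shows "unit_nbhd_base H ((`) q ` \<N>)"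
proof -
  interpret q: group_hom G H q
    using H q by (simp add: group_hom_def group_hom_axioms_def)
  show ?thesis
  proof (rule unit_nbhd_base.intro[OF H], unfold_locales)
    show "(`) q ` \<N> \<noteq> {}" using ex_nbhd by simp
    show "U \<subseteq> carrier H" if "U \<in> (`) q ` \<N>" for U
      using that nbhd_subset onto by blast
    show "\<one>\<^bsub>H\<^esub> \<in> U" if "U \<in> (`) q ` \<N>" for U
      using that by (auto intro!: image_eqI[of _ q \<one>] one_in_nbhd)
    show "\<exists>W\<in>(`) q ` \<N>. W \<subseteq> U \<inter> V" if UV: "U \<in> (`) q ` \<N>" "V \<in> (`) q ` \<N>" for U V
    proof -
      obtain U' V' where "U' \<in> \<N>" "V' \<in> \<N>" and eq: "U = q ` U'" "V = q ` V'"
        using UV by blast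
      then obtain W where "W \<in> \<N>" "W \<subseteq> U' \<inter> V'" using nbhd_Int by blast
      then show ?thesis using eq by (intro bexI[of _ "q ` W"]) auto
    qed
    show "\<exists>V\<in>(`) q ` \<N>. \<forall>x\<in>V. \<forall>y\<in>V. x \<otimes>\<^bsub>H\<^esub> y \<in> U" if U: "U \<in> (`) q ` \<N>" for U
    proof -
      obtain U' where U': "U' \<in> \<N>" "U = q ` U'" using U by blast
      obtain V where V: "V \<in> \<N>" "\<forall>x\<in>V. \<forall>y\<in>V. x \<otimes> y \<in> U'" using nbhd_mult[OF U'(1)] by blast
      have "q x \<otimes>\<^bsub>H\<^esub> q y \<in> U" if "x \<in> V" "y \<in> V" for x y
      proof -
        have "x \<in> carrier G" "y \<in> carrier G" using that nbhd_subset[OF V(1)] by auto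
        then have "q x \<otimes>\<^bsub>H\<^esub> q y = q (x \<otimes> y)" by simp
        then show ?thesis using that V U' by blast
      qed
      then show ?thesis using V(1) by (intro bexI[of _ "q ` V"]) auto
    qed
    show "\<exists>V\<in>(`) q ` \<N>. \<forall>x\<in>V. inv\<^bsub>H\<^esub> x \<in> U" if U: "U \<in> (`) q ` \<N>" for U
    proof -
      obtain U' where U': "U' \<in> \<N>" "U = q ` U'" using U by blast
      obtain V where V: "V \<in> \<N>" "\<forall>x\<in>V. inv x \<in> U'" using nbhd_inv[OF U'(1)] by blast
      have "inv\<^bsub>H\<^esub> (q x) \<in> U" if "x \<in> V" for x
      proof -
        have "x \<in> carrier G" using that nbhd_subset[OF V(1)] by auto
        then have "inv\<^bsub>H\<^esub> (q x) = q (inv x)" by simp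
        then show ?thesis using that V U' by blast
      qed
      then show ?thesis using V(1) by (intro bexI[of _ "q ` V"]) auto
    qed
    show "\<exists>V\<in>(`) q ` \<N>. \<forall>x\<in>V. inv\<^bsub>H\<^esub> g \<otimes>\<^bsub>H\<^esub> x \<otimes>\<^bsub>H\<^esub> g \<in> U"
      if Ug: "U \<in> (`) q ` \<N>" "g \<in> carrier H" for U g
    proof -
      obtain U' g' where U': "U' \<in> \<N>" "U = q ` U'" and g': "g' \<in> carrier G" "g = q g'"
        using Ug onto by blast
      obtain V where V: "V \<in> \<N>" "\<forall>x\<in>V. inv g' \<otimes> x \<otimes> g' \<in> U'"
        using nbhd_conj[OF U'(1) g'(1)] by blast
      have "inv\<^bsub>H\<^esub> g \<otimes>\<^bsub>H\<^esub> q x \<otimes>\<^bsub>H\<^esub> g \<in> U" if "x \<in> V" for x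
      proof -
        have "x \<in> carrier G" using that nbhd_subset[OF V(1)] by auto
        then have "inv\<^bsub>H\<^esub> g \<otimes>\<^bsub>H\<^esub> q x \<otimes>\<^bsub>H\<^esub> g = q (inv g' \<otimes> x \<otimes> g')" using g' by simp
        then show ?thesis using that V U' by blast
      qed
      then show ?thesis using V(1) by (intro bexI[of _ "q ` V"]) auto
    qed
  qed
qed

text \<open>The intersection of the base is the closure of the unit: the part of the group which has to
  be divided out in order to obtain a Hausdorff topology.\<close>

lemma Inter_nbhd_normal: "\<Inter>\<N> \<lhd> G"
proof -
  have carr: "x \<in> carrier G" if "x \<in> \<Inter>\<N>" for x
    using that ex_nbhd nbhd_subset by (metis InterE ex_in_conv subsetD)
  have "subgroup (\<Inter>\<N>) G"
  proof
    show "\<Inter>\<N> \<subseteq> carrier G" using carr by blast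
    show "\<one> \<in> \<Inter>\<N>" using one_in_nbhd by blast
    show "x \<otimes> y \<in> \<Inter>\<N>" if "x \<in> \<Inter>\<N>" "y \<in> \<Inter>\<N>" for x y
      using that nbhd_mult by (meson InterE InterI)
    show "inv x \<in> \<Inter>\<N>" if "x \<in> \<Inter>\<N>" for x
      using that nbhd_inv by (meson InterE InterI)
  qed
  moreover have "g \<otimes> x \<otimes> inv g \<in> \<Inter>\<N>" if gx: "g \<in> carrier G" "x \<in> \<Inter>\<N>" for g x
  proof
    fix U assume "U \<in> \<N>"
    then obtain V where "V \<in> \<N>" "\<forall>y\<in>V. inv (inv g) \<otimes> y \<otimes> inv g \<in> U"
      using nbhd_conj[of U "inv g"] gx(1) by auto
    then show "g \<otimes> x \<otimes> inv g \<in> U" using gx by auto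
  qed
  ultimately show ?thesis by (simp add: normal_inv_iff)
qed

text \<open>The quotient is realised as the image under a map \<open>q\<close> whose fibres are the cosets of the
  kernel, so that its carrier can be placed inside any type that is large enough. The family of
  images has trivial intersection: if \<open>q g = q v\<close> with \<open>v \<in> V\<close>, then \<open>g v\<inverse>\<close> lies in the kernel and
  hence in \<open>V\<close>, so \<open>g\<close> lies in \<open>V V\<close>.\<close>

lemma Hausdorff_image_group:
  assumes q: "weak_group_morphism q (\<Inter>\<N>) G"
  shows "unit_nbhd_base (image_group q G) ((`) q ` \<N>)"
    and "topological_group (image_group q G)
           (unit_nbhd_base.group_topology (image_group q G) ((`) q ` \<N>))"
proof -
  have hom: "q \<in> hom G (image_group q G)" by (rule weak_group_morphism_is_hom[OF q])
  show base: "unit_nbhd_base (image_group q G) ((`) q ` \<N>)"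
    by (rule nbhd_base_image[OF image_group_is_group[OF q] hom]) (simp add: image_group_carrier)
  have "z = q \<one>" if z: "z \<in> \<Inter>((`) q ` \<N>)" for z
  proof -
    obtain g where g: "g \<in> carrier G" "z = q g"
      using z ex_nbhd nbhd_subset by blast
    have "g \<in> U" if U: "U \<in> \<N>" for U
    proof -
      obtain V where V: "V \<in> \<N>" "\<forall>x\<in>V. \<forall>y\<in>V. x \<otimes> y \<in> U" using nbhd_mult[OF U] by blast
      then obtain v where v: "v \<in> V" "z = q v" using z by blast
      have vc: "v \<in> carrier G" using v V nbhd_subset by blast
      then have "g \<otimes> inv v \<in> V"
        using weak_group_morphism.inj_mod_subgroup[OF q g(1) vc] g v V by auto
      then have "g \<otimes> inv v \<otimes> v \<in> U" using V v by blast
      then show ?thesis using g vc by (simp add: m_assoc)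
    qed
    then have "g \<otimes> inv \<one> \<in> \<Inter>\<N>" using g by simp
    then show ?thesis
      using weak_group_morphism.inj_mod_subgroup[OF q g(1) one_closed] g by simp
  qed
  then have "\<Inter>((`) q ` \<N>) \<subseteq> {\<one>\<^bsub>image_group q G\<^esub>}" by (auto simp: image_group_one)
  then show "topological_group (image_group q G)
           (unit_nbhd_base.group_topology (image_group q G) ((`) q ` \<N>))"
    by (rule unit_nbhd_base.topological_group_group_topology[OF base])
qed

text \<open>A net is Cauchy for the two-sided (Raikov) uniformity: for every \<open>U\<close> it is eventually in some
  \<open>aU\<close> and eventually in some \<open>Ub\<close>. The one-sided notions are not preserved by inversion.\<close>

definition cauchy :: "'i filter \<Rightarrow> ('i \<Rightarrow> 'a) \<Rightarrow> bool" where
  "cauchy F \<gamma> \<longleftrightarrow> (\<forall>i. \<gamma> i \<in> carrier G) \<and>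
     (\<forall>U\<in>\<N>. (\<exists>a\<in>carrier G. \<forall>\<^sub>F i in F. inv a \<otimes> \<gamma> i \<in> U) \<and>
             (\<exists>b\<in>carrier G. \<forall>\<^sub>F i in F. \<gamma> i \<otimes> inv b \<in> U))"

lemma cauchy_const: "c \<in> carrier G \<Longrightarrow> cauchy F (\<lambda>_. c)"
  unfolding cauchy_def using one_in_nbhd by (auto intro!: bexI[of _ c])

lemma cauchy_inv:
  assumes \<gamma>: "cauchy F \<gamma>"
  shows "cauchy F (\<lambda>i. inv (\<gamma> i))"
  unfolding cauchy_def
proof (intro conjI ballI allI)
  have c: "\<gamma> i \<in> carrier G" for i using \<gamma> by (simp add: cauchy_def)
  then show "inv (\<gamma> i) \<in> carrier G" for i by simp
  fix U assume "U \<in> \<N>"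
  then obtain V where V: "V \<in> \<N>" "\<forall>x\<in>V. inv x \<in> U" using nbhd_inv by blast
  obtain a b where a: "a \<in> carrier G" "\<forall>\<^sub>F i in F. inv a \<otimes> \<gamma> i \<in> V"
    and b: "b \<in> carrier G" "\<forall>\<^sub>F i in F. \<gamma> i \<otimes> inv b \<in> V"
    using \<gamma> V(1) unfolding cauchy_def by blast
  have "\<forall>\<^sub>F i in F. inv (inv b) \<otimes> inv (\<gamma> i) \<in> U"
    using b(2)
  proof eventually_elim
    case (elim i)
    then have "inv (\<gamma> i \<otimes> inv b) \<in> U" using V by blast
    then show ?case using b c by (simp add: inv_mult_group)
  qed
  then show "\<exists>a\<in>carrier G. \<forall>\<^sub>F i in F. inv a \<otimes> inv (\<gamma> i) \<in> U" using b by blast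
  have "\<forall>\<^sub>F i in F. inv (\<gamma> i) \<otimes> inv (inv a) \<in> U"
    using a(2)
  proof eventually_elim
    case (elim i)
    then have "inv (inv a \<otimes> \<gamma> i) \<in> U" using V by blast
    then show ?case using a c by (simp add: inv_mult_group)
  qed
  then show "\<exists>b\<in>carrier G. \<forall>\<^sub>F i in F. inv (\<gamma> i) \<otimes> inv b \<in> U" using a by blast
qed

lemma cauchy_mult:
  assumes \<gamma>: "cauchy F \<gamma>" and \<delta>: "cauchy F \<delta>"
  shows "cauchy F (\<lambda>i. \<gamma> i \<otimes> \<delta> i)"
  unfolding cauchy_def
proof (intro conjI ballI allI)
  have c: "\<gamma> i \<in> carrier G" "\<delta> i \<in> carrier G" for i using \<gamma> \<delta> by (simp_all add: cauchy_def)
  then show "\<gamma> i \<otimes> \<delta> i \<in> carrier G" for i by simp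
  fix U assume "U \<in> \<N>"
  then obtain V where V: "V \<in> \<N>" "\<forall>x\<in>V. \<forall>y\<in>V. x \<otimes> y \<in> U" using nbhd_mult by blast
  show "\<exists>a\<in>carrier G. \<forall>\<^sub>F i in F. inv a \<otimes> (\<gamma> i \<otimes> \<delta> i) \<in> U"
  proof -
    obtain b where b: "b \<in> carrier G" "\<forall>\<^sub>F i in F. inv b \<otimes> \<delta> i \<in> V"
      using \<delta> V(1) unfolding cauchy_def by blast
    obtain W where W: "W \<in> \<N>" "\<forall>x\<in>W. inv b \<otimes> x \<otimes> b \<in> V" using nbhd_conj[OF V(1) b(1)] by blast
    obtain a where a: "a \<in> carrier G" "\<forall>\<^sub>F i in F. inv a \<otimes> \<gamma> i \<in> W"
      using \<gamma> W(1) unfolding cauchy_def by blast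
    have "\<forall>\<^sub>F i in F. inv (a \<otimes> b) \<otimes> (\<gamma> i \<otimes> \<delta> i) \<in> U"
      using a(2) b(2)
    proof eventually_elim
      case (elim i)
      then have "(inv b \<otimes> (inv a \<otimes> \<gamma> i) \<otimes> b) \<otimes> (inv b \<otimes> \<delta> i) \<in> U" using V W by blast
      moreover have "b \<otimes> (inv b \<otimes> \<delta> i) = \<delta> i" using b c by (simp add: m_assoc[symmetric])
      ultimately show ?case using a b c by (simp add: inv_mult_group m_assoc)
    qed
    then show ?thesis using a b by blast
  qed
  show "\<exists>b\<in>carrier G. \<forall>\<^sub>F i in F. \<gamma> i \<otimes> \<delta> i \<otimes> inv b \<in> U"
  proof -
    obtain a where a: "a \<in> carrier G" "\<forall>\<^sub>F i in F. \<gamma> i \<otimes> inv a \<in> V"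
      using \<gamma> V(1) unfolding cauchy_def by blast
    obtain W where W: "W \<in> \<N>" "\<forall>x\<in>W. inv (inv a) \<otimes> x \<otimes> inv a \<in> V"
      using nbhd_conj[OF V(1), of "inv a"] a(1) by auto
    obtain b where b: "b \<in> carrier G" "\<forall>\<^sub>F i in F. \<delta> i \<otimes> inv b \<in> W"
      using \<delta> W(1) unfolding cauchy_def by blast
    have "\<forall>\<^sub>F i in F. \<gamma> i \<otimes> \<delta> i \<otimes> inv (a \<otimes> b) \<in> U"
      using a(2) b(2)
    proof eventually_elim
      case (elim i)
      then have "(\<gamma> i \<otimes> inv a) \<otimes> (inv (inv a) \<otimes> (\<delta> i \<otimes> inv b) \<otimes> inv a) \<in> U" using V W by blast
      moreover have "inv a \<otimes> (a \<otimes> (\<delta> i \<otimes> (inv b \<otimes> inv a))) = \<delta> i \<otimes> (inv b \<otimes> inv a)"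
        using a b c by (simp add: m_assoc[symmetric])
      ultimately show ?case using a b c by (simp add: inv_mult_group m_assoc)
    qed
    then show ?thesis using a b by blast
  qed
qed

lemma subgroup_cauchy: "subgroup {\<gamma>. cauchy F \<gamma>} (product_group UNIV (\<lambda>_. G))"
proof
  show "{\<gamma>. cauchy F \<gamma>} \<subseteq> carrier (product_group UNIV (\<lambda>_. G))"
    by (auto simp: cauchy_def)
  show "\<gamma> \<otimes>\<^bsub>product_group UNIV (\<lambda>_. G)\<^esub> \<delta> \<in> {\<gamma>. cauchy F \<gamma>}"
    if "\<gamma> \<in> {\<gamma>. cauchy F \<gamma>}" "\<delta> \<in> {\<gamma>. cauchy F \<gamma>}" for \<gamma> \<delta>
    using that cauchy_mult by (simp add: restrict_UNIV)
  show "\<one>\<^bsub>product_group UNIV (\<lambda>_. G)\<^esub> \<in> {\<gamma>. cauchy F \<gamma>}"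
    using cauchy_const[OF one_closed] by (simp add: restrict_UNIV)
  show "inv\<^bsub>product_group UNIV (\<lambda>_. G)\<^esub> \<gamma> \<in> {\<gamma>. cauchy F \<gamma>}"
    if "\<gamma> \<in> {\<gamma>. cauchy F \<gamma>}" for \<gamma>
  proof -
    have "\<gamma> \<in> (\<Pi>\<^sub>E i\<in>UNIV. carrier G)" using that by (auto simp: cauchy_def)
    then show ?thesis using that cauchy_inv is_group by (simp add: restrict_UNIV)
  qed
qed

text \<open>Conjugating a net that tends to the unit by an arbitrary net may destroy the convergence.
  Conjugation by a Cauchy net \<open>\<gamma>\<close> does not, since \<open>\<gamma>\<close> is eventually close to a constant \<open>a\<close>. This is
  where the restriction to Cauchy nets enters.\<close>

lemma nbhd_base_eventually:
  assumes \<Gamma>: "subgroup \<Gamma> (product_group UNIV (\<lambda>_. G))" and cau: "\<Gamma> \<subseteq> {\<gamma>. cauchy F \<gamma>}"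
  shows "unit_nbhd_base (product_group UNIV (\<lambda>_. G)\<lparr>carrier := \<Gamma>\<rparr>)
           ((\<lambda>U. {\<gamma>\<in>\<Gamma>. \<forall>\<^sub>F i in F. \<gamma> i \<in> U}) ` \<N>)"
    (is "unit_nbhd_base ?\<Gamma> (?star ` \<N>)")
proof -
  have grP: "group (product_group UNIV (\<lambda>_. G))" by simp
  then have gr: "group ?\<Gamma>" using subgroup.subgroup_is_group[OF \<Gamma>] by blast
  have c: "\<gamma> i \<in> carrier G" if "\<gamma> \<in> \<Gamma>" for \<gamma> i using that cau by (auto simp: cauchy_def)
  have inv_eq: "inv\<^bsub>?\<Gamma>\<^esub> \<gamma> = (\<lambda>i. inv (\<gamma> i))" if "\<gamma> \<in> \<Gamma>" for \<gamma>
    using group.m_inv_consistent[OF grP \<Gamma> that] subgroup.mem_carrier[OF \<Gamma> that] is_group by (simp add: restrict_UNIV)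
  have mult_eq: "\<gamma> \<otimes>\<^bsub>?\<Gamma>\<^esub> \<delta> = (\<lambda>i. \<gamma> i \<otimes> \<delta> i)" for \<gamma> \<delta> by (simp add: restrict_UNIV)
  have multG: "(\<lambda>i. \<gamma> i \<otimes> \<delta> i) \<in> \<Gamma>" if "\<gamma> \<in> \<Gamma>" "\<delta> \<in> \<Gamma>" for \<gamma> \<delta>
    using subgroup.m_closed[OF \<Gamma> that] by (simp add: restrict_UNIV)
  have invG: "(\<lambda>i. inv (\<gamma> i)) \<in> \<Gamma>" if "\<gamma> \<in> \<Gamma>" for \<gamma>
    using subgroup.m_inv_closed[OF \<Gamma> that] subgroup.mem_carrier[OF \<Gamma> that] is_group by (simp add: restrict_UNIV)
  show ?thesis
  proof (rule unit_nbhd_base.intro[OF gr], unfold_locales)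
    show "?star ` \<N> \<noteq> {}" using ex_nbhd by simp
    show "A \<subseteq> carrier ?\<Gamma>" if "A \<in> ?star ` \<N>" for A using that by auto
    show "\<one>\<^bsub>?\<Gamma>\<^esub> \<in> A" if "A \<in> ?star ` \<N>" for A
      using that one_in_nbhd subgroup.one_closed[OF \<Gamma>] by (auto simp: restrict_UNIV)
    show "\<exists>C\<in>?star ` \<N>. C \<subseteq> A \<inter> B" if A: "A \<in> ?star ` \<N>" and B: "B \<in> ?star ` \<N>" for A B
    proof -
      obtain U V where "U \<in> \<N>" "V \<in> \<N>" and AB: "A = ?star U" "B = ?star V" using A B by blast
      then obtain W where "W \<in> \<N>" "W \<subseteq> U \<inter> V" using nbhd_Int by blast
      then show ?thesis
        using AB by (intro bexI[of _ "?star W"]) (auto elim: eventually_mono)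
    qed
    show "\<exists>B\<in>?star ` \<N>. \<forall>\<gamma>\<in>B. \<forall>\<delta>\<in>B. \<gamma> \<otimes>\<^bsub>?\<Gamma>\<^esub> \<delta> \<in> A" if A: "A \<in> ?star ` \<N>" for A
    proof -
      obtain U where U: "U \<in> \<N>" "A = ?star U" using A by blast
      obtain V where V: "V \<in> \<N>" "\<forall>x\<in>V. \<forall>y\<in>V. x \<otimes> y \<in> U" using nbhd_mult[OF U(1)] by blast
      have "\<gamma> \<otimes>\<^bsub>?\<Gamma>\<^esub> \<delta> \<in> A" if "\<gamma> \<in> ?star V" "\<delta> \<in> ?star V" for \<gamma> \<delta>
      proof -
        have "\<forall>\<^sub>F i in F. \<gamma> i \<in> V" "\<forall>\<^sub>F i in F. \<delta> i \<in> V" using that by auto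
        then have "\<forall>\<^sub>F i in F. \<gamma> i \<otimes> \<delta> i \<in> U" by eventually_elim (use V in blast)
        then show ?thesis unfolding mult_eq U using multG that by auto
      qed
      then show ?thesis using V(1) by blast
    qed
    show "\<exists>B\<in>?star ` \<N>. \<forall>\<gamma>\<in>B. inv\<^bsub>?\<Gamma>\<^esub> \<gamma> \<in> A" if A: "A \<in> ?star ` \<N>" for A
    proof -
      obtain U where U: "U \<in> \<N>" "A = ?star U" using A by blast
      obtain V where V: "V \<in> \<N>" "\<forall>x\<in>V. inv x \<in> U" using nbhd_inv[OF U(1)] by blast
      have "inv\<^bsub>?\<Gamma>\<^esub> \<gamma> \<in> A" if "\<gamma> \<in> ?star V" for \<gamma>
      proof -
        have g: "\<gamma> \<in> \<Gamma>" "\<forall>\<^sub>F i in F. \<gamma> i \<in> V" using that by auto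
        have "\<forall>\<^sub>F i in F. inv (\<gamma> i) \<in> U" using g(2) by eventually_elim (use V in blast)
        then show ?thesis unfolding inv_eq[OF g(1)] U using invG g by auto
      qed
      then show ?thesis using V(1) by blast
    qed
    show "\<exists>B\<in>?star ` \<N>. \<forall>\<delta>\<in>B. inv\<^bsub>?\<Gamma>\<^esub> \<gamma> \<otimes>\<^bsub>?\<Gamma>\<^esub> \<delta> \<otimes>\<^bsub>?\<Gamma>\<^esub> \<gamma> \<in> A"
      if A: "A \<in> ?star ` \<N>" and "\<gamma> \<in> carrier ?\<Gamma>" for A \<gamma>
    proof -
      have \<gamma>: "\<gamma> \<in> \<Gamma>" "cauchy F \<gamma>" using that cau by auto
      obtain U where U: "U \<in> \<N>" "A = ?star U" using A by blast
      obtain W where W: "W \<in> \<N>" "\<And>x y z. \<lbrakk>x \<in> W; y \<in> W; z \<in> W\<rbrakk> \<Longrightarrow> inv x \<otimes> y \<otimes> z \<in> U"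
        using nbhd_inv_mult_mult[OF U(1)] by metis
      obtain a where a: "a \<in> carrier G" "\<forall>\<^sub>F i in F. inv a \<otimes> \<gamma> i \<in> W"
        using \<gamma> W(1) unfolding cauchy_def by blast
      obtain V where V: "V \<in> \<N>" "\<forall>x\<in>V. inv a \<otimes> x \<otimes> a \<in> W" using nbhd_conj[OF W(1) a(1)] by blast
      have "inv\<^bsub>?\<Gamma>\<^esub> \<gamma> \<otimes>\<^bsub>?\<Gamma>\<^esub> \<delta> \<otimes>\<^bsub>?\<Gamma>\<^esub> \<gamma> \<in> A" if "\<delta> \<in> ?star V" for \<delta>
      proof -
        have d: "\<delta> \<in> \<Gamma>" "\<forall>\<^sub>F i in F. \<delta> i \<in> V" using that by auto
        have "\<forall>\<^sub>F i in F. inv (\<gamma> i) \<otimes> \<delta> i \<otimes> \<gamma> i \<in> U"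
          using d(2) a(2)
        proof eventually_elim
          case (elim i)
          \<comment> \<open>with \<open>\<gamma> i = a w\<close> the conjugate is \<open>w\<inverse> (a\<inverse> \<delta> a) w\<close>\<close>
          then have "inv (inv a \<otimes> \<gamma> i) \<otimes> (inv a \<otimes> \<delta> i \<otimes> a) \<otimes> (inv a \<otimes> \<gamma> i) \<in> U"
            using W V by blast
          moreover have "a \<otimes> (inv a \<otimes> y) = y" if "y \<in> carrier G" for y
            using a that by (simp add: m_assoc[symmetric])
          ultimately show ?case
            using a c[OF d(1), of i] c[OF \<gamma>(1), of i] by (simp add: inv_mult_group m_assoc)
        qed
        then show ?thesis
          unfolding inv_eq[OF \<gamma>(1)] mult_eq U using multG[OF multG[OF invG[OF \<gamma>(1)] d(1)] \<gamma>(1)] by auto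
      qed
      then show ?thesis using V(1) by blast
    qed
  qed
qed

end

text \<open>Any type into which \<open>G\<close> injects can carry the quotient by \<open>H\<close>: each coset is represented by
  the image of a chosen element.\<close>

lemma (in normal) ex_weak_group_morphism:
  fixes e :: "'a \<Rightarrow> 'c"
  assumes e: "inj_on e (carrier G)"
  obtains q :: "'a \<Rightarrow> 'c" where "weak_group_morphism q H G"
proof -
  define r where "r C = (SOME g. g \<in> carrier G \<and> H #> g = C)" for C
  have r: "r (H #> g) \<in> carrier G \<and> H #> r (H #> g) = H #> g" if "g \<in> carrier G" for g
    unfolding r_def by (rule someI_ex) (use that in blast)
  have "weak_group_morphism (\<lambda>g. e (r (H #> g))) H G"
  proof (rule weak_group_morphismsI[OF normal_axioms])
    fix a b assume a: "a \<in> carrier G" and b: "b \<in> carrier G"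
    have "e (r (H #> a)) = e (r (H #> b)) \<longleftrightarrow> r (H #> a) = r (H #> b)"
      using r[OF a] r[OF b] e by (simp add: inj_on_eq_iff)
    also have "\<dots> \<longleftrightarrow> H #> a = H #> b"
      using r[OF a] r[OF b] by metis
    also have "\<dots> \<longleftrightarrow> a \<otimes> inv b \<in> H"
    proof
      assume "H #> a = H #> b"
      then have "a \<in> H #> b" using rcos_self[OF a subgroup_axioms] by simp
      then show "a \<otimes> inv b \<in> H" using rcos_module[OF is_group b a] by simp
    next
      assume "a \<otimes> inv b \<in> H"
      then have "a \<in> H #> b" using rcos_module[OF is_group b a] by simp
      then show "H #> a = H #> b" using repr_independence[OF _ b subgroup_axioms] by simp
    qed
    finally show "e (r (H #> a)) = e (r (H #> b)) \<longleftrightarrow> a \<otimes> inv b \<in> H" .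
  qed
  then show thesis by (rule that)
qed

section \<open>Completeness of groups that are closed in all Hausdorff groups\<close>

lemma continuous_map_pointwise_mult:
  assumes mult: "continuous_map (prod_topology T T) T (\<lambda>(x, y). x \<otimes>\<^bsub>S\<^esub> y)"
    and f: "continuous_map Z T f" and g: "continuous_map Z T g"
  shows "continuous_map Z T (\<lambda>z. f z \<otimes>\<^bsub>S\<^esub> g z)"
  using continuous_map_compose[OF continuous_map_pairedI[OF f g] mult] by (simp add: o_def)

context topological_group
begin

lemma openin_translates:
  assumes "openin T D" "g \<in> carrier G"
  shows "openin T {x \<in> carrier G. g \<otimes> x \<in> D}" and "openin T {x \<in> carrier G. x \<otimes> g \<in> D}"
proof -
  have "continuous_map T T (\<lambda>x. g \<otimes> x)" "continuous_map T T (\<lambda>x. x \<otimes> g)"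
    using assms(2) topspace_eq
    by (intro continuous_map_pointwise_mult[OF continuous_mult]; simp)+
  then show "openin T {x \<in> carrier G. g \<otimes> x \<in> D}" "openin T {x \<in> carrier G. x \<otimes> g \<in> D}"
    using openin_continuous_map_preimage[OF _ assms(1)] topspace_eq by force+
qed

abbreviation unit_nbhds :: "'a set set" where
  "unit_nbhds \<equiv> {U. openin T U \<and> \<one> \<in> U}"

lemma unit_nbhd_base_unit_nbhds: "unit_nbhd_base G unit_nbhds"
proof
  show "unit_nbhds \<noteq> {}" using topspace_eq openin_topspace[of T] by auto
  show "U \<subseteq> carrier G" if "U \<in> unit_nbhds" for U
    using that openin_subset topspace_eq by auto
  show "\<one> \<in> U" if "U \<in> unit_nbhds" for U using that by simp
  show "\<exists>W\<in>unit_nbhds. W \<subseteq> U \<inter> V" if "U \<in> unit_nbhds" "V \<in> unit_nbhds" for U V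
    using that by (intro bexI[of _ "U \<inter> V"]) auto
  show "\<exists>V\<in>unit_nbhds. \<forall>x\<in>V. \<forall>y\<in>V. x \<otimes> y \<in> U" if U: "U \<in> unit_nbhds" for U
  proof -
    define P where "P = {p \<in> topspace (prod_topology T T). (case p of (x, y) \<Rightarrow> x \<otimes> y) \<in> U}"
    have "openin (prod_topology T T) P"
      unfolding P_def using openin_continuous_map_preimage[OF continuous_mult, of U] U by simp
    moreover have "(\<one>, \<one>) \<in> P"
      using U topspace_eq by (simp add: P_def)
    ultimately obtain A B where "openin T A" "openin T B" "\<one> \<in> A" "\<one> \<in> B" and "A \<times> B \<subseteq> P"
      unfolding openin_prod_topology_alt by metis
    moreover have "x \<otimes> y \<in> U" if "(x, y) \<in> P" for x y
      using that by (simp add: P_def)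
    ultimately show ?thesis
      by (intro bexI[of _ "A \<inter> B"]) (auto simp: openin_Int subset_iff)
  qed
  show "\<exists>V\<in>unit_nbhds. \<forall>x\<in>V. inv x \<in> U" if "U \<in> unit_nbhds" for U
    using openin_continuous_map_preimage[OF continuous_inv, of U] that topspace_eq
    by (intro bexI[of _ "{x \<in> topspace T. inv x \<in> U}"]) auto
  show "\<exists>V\<in>unit_nbhds. \<forall>x\<in>V. inv g \<otimes> x \<otimes> g \<in> U" if U: "U \<in> unit_nbhds" and g: "g \<in> carrier G" for U g
  proof -
    have "openin T {x \<in> carrier G. inv g \<otimes> x \<in> {x \<in> carrier G. x \<otimes> g \<in> U}}"
      using U g by (intro openin_translates) auto
    then show ?thesis
      using U g by (intro bexI[of _ "{x \<in> carrier G. inv g \<otimes> x \<in> {x \<in> carrier G. x \<otimes> g \<in> U}}"]) auto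
  qed
qed

sublocale unit_nbhd_base G unit_nbhds
  by (rule unit_nbhd_base_unit_nbhds)

lemma Inter_unit_nbhds: "\<Inter>unit_nbhds \<subseteq> {\<one>}"
proof
  fix x assume x: "x \<in> \<Inter>unit_nbhds"
  show "x \<in> {\<one>}"
  proof (rule ccontr)
    assume "x \<notin> {\<one>}"
    then have ne: "x \<noteq> \<one>" by simp
    have "x \<in> topspace T" using x topspace_eq openin_topspace[of T] by auto
    then obtain U where "openin T U" "\<one> \<in> U" "x \<notin> U"
      using Hausdorff ne topspace_eq unfolding Hausdorff_space_def disjnt_iff by (metis one_closed)
    then show False using x by blast
  qed
qed

text \<open>If \<open>u\<close> has no limit, then adjoining one gives a group in which \<open>G\<close> is not closed. The adjunction
  avoids the full Raikov completion: inside the group of all nets over the same index type, the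
  constants and \<open>u\<close> generate a subgroup \<open>\<Gamma>\<close> of Cauchy nets, topologised by the sets of nets that are
  eventually in \<open>U\<close>. In its Hausdorff quotient \<open>Q\<close> the classes of the constants form a continuous
  injective image of \<open>G\<close>, and the class of \<open>u\<close> lies in the closure of that image. If the image is
  closed, then \<open>u\<close> is equivalent to a constant, which is the limit sought. Using only the generated
  subgroup keeps \<open>\<Gamma>\<close> as small as \<open>G\<close>, so that \<open>Q\<close> fits into every type that \<open>G\<close> fits into.\<close>

theorem Cauchy_net_converges:
  fixes u :: "'i \<Rightarrow> 'a" and F :: "'i filter"
  assumes closed: "iTG_closed TYPE('b) G T"
    and inf: "infinite (carrier G)" and card: "carrier G \<lesssim> (UNIV :: 'b set)"
    and F: "F \<noteq> bot" and u: "cauchy F u"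
  shows "\<exists>x. limitin T u x F"
proof -
  let ?P = "product_group (UNIV :: 'i set) (\<lambda>_. G)"
  let ?A = "(\<lambda>c (_::'i). c) ` carrier G \<union> {u}"
  define \<Gamma> where "\<Gamma> = generate ?P ?A"
  let ?G = "?P\<lparr>carrier := \<Gamma>\<rparr>"
  let ?star = "\<lambda>U. {\<gamma>\<in>\<Gamma>. \<forall>\<^sub>F i in F. \<gamma> i \<in> U}"
  have grP: "group ?P" by simp
  have Asub: "?A \<subseteq> {\<gamma>. cauchy F \<gamma>}" using u cauchy_const by auto
  then have AP: "?A \<subseteq> carrier ?P" using subgroup.subset[OF subgroup_cauchy] by blast
  have sub: "subgroup \<Gamma> ?P" unfolding \<Gamma>_def by (rule group.generate_is_subgroup[OF grP AP])
  have \<Gamma>_cauchy: "\<Gamma> \<subseteq> {\<gamma>. cauchy F \<gamma>}"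
    unfolding \<Gamma>_def by (rule group.generate_subgroup_incl[OF grP Asub subgroup_cauchy])
  have c\<Gamma>: "(\<lambda>_. c) \<in> \<Gamma>" if "c \<in> carrier G" for c
    unfolding \<Gamma>_def using that by (intro generate.incl) auto
  have u\<Gamma>: "u \<in> \<Gamma>" unfolding \<Gamma>_def by (intro generate.incl) auto
  have uc: "u i \<in> carrier G" for i using u by (simp add: cauchy_def)
  interpret \<Gamma>: unit_nbhd_base ?G "?star ` unit_nbhds"
    by (rule nbhd_base_eventually[OF sub \<Gamma>_cauchy])
  have mult\<Gamma>: "\<gamma> \<otimes>\<^bsub>?G\<^esub> \<delta> = (\<lambda>i. \<gamma> i \<otimes> \<delta> i)" for \<gamma> \<delta> by (simp add: restrict_UNIV)
  have inv\<Gamma>: "inv\<^bsub>?G\<^esub> \<gamma> = (\<lambda>i. inv (\<gamma> i))" if "\<gamma> \<in> \<Gamma>" for \<gamma>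
    using group.m_inv_consistent[OF grP sub that] subgroup.mem_carrier[OF sub that] is_group
    by (simp add: restrict_UNIV)
  have "\<Gamma> \<lesssim> (UNIV :: 'b set)"
  proof -
    have "inj_on (\<lambda>c (_::'i). c) (carrier G)" by (auto simp: inj_on_def fun_eq_iff)
    then have inf_const: "infinite ((\<lambda>c (_::'i). c) ` carrier G)"
      using inf by (simp add: finite_image_iff)
    then have "infinite ?A" by simp
    then have "\<Gamma> \<lesssim> ?A"
      unfolding \<Gamma>_def using group.generate_lepoll_infinite[OF grP AP] by blast
    also have "?A \<lesssim> (\<lambda>c (_::'i). c) ` carrier G" using infinite_insert_lepoll[OF inf_const, of u] by simp
    also have "(\<lambda>c (_::'i). c) ` carrier G \<lesssim> carrier G" by (rule image_lepoll)
    also note card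
    finally show ?thesis .
  qed
  then obtain e :: "('i \<Rightarrow> 'a) \<Rightarrow> 'b" where "inj_on e (carrier ?G)"
    by (auto simp: lepoll_def)
  then obtain q :: "('i \<Rightarrow> 'a) \<Rightarrow> 'b" where q: "weak_group_morphism q (\<Inter>(?star ` unit_nbhds)) ?G"
    using normal.ex_weak_group_morphism[OF \<Gamma>.Inter_nbhd_normal] by blast
  let ?Q = "image_group q ?G" and ?M = "(`) q ` ?star ` unit_nbhds"
  have baseQ: "unit_nbhd_base ?Q ?M" and topQ: "topological_group ?Q (unit_nbhd_base.group_topology ?Q ?M)"
    by (rule \<Gamma>.Hausdorff_image_group[OF q])+
  define \<tau> where "\<tau> = unit_nbhd_base.group_topology ?Q ?M"
  interpret Q: topological_group ?Q \<tau> using topQ by (simp add: \<tau>_def)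
  have homq: "q \<in> hom ?G ?Q" by (rule \<Gamma>.weak_group_morphism_is_hom[OF q])
  have q_eq: "q \<gamma> = q \<delta> \<longleftrightarrow> (\<forall>U\<in>unit_nbhds. \<forall>\<^sub>F i in F. \<gamma> i \<otimes> inv (\<delta> i) \<in> U)"
    if "\<gamma> \<in> \<Gamma>" "\<delta> \<in> \<Gamma>" for \<gamma> \<delta>
  proof -
    have "\<gamma> \<otimes>\<^bsub>?G\<^esub> inv\<^bsub>?G\<^esub> \<delta> \<in> \<Gamma>"
      using \<Gamma>.m_closed[of \<gamma> "inv\<^bsub>?G\<^esub> \<delta>"] \<Gamma>.inv_closed[of \<delta>] that by simp
    then show ?thesis
      using weak_group_morphism.inj_mod_subgroup[OF q, of \<gamma> \<delta>] that ex_nbhd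
      unfolding inv\<Gamma>[OF that(2)] mult\<Gamma> by auto
  qed
  have q_mult: "q (\<lambda>i. \<gamma> i \<otimes> \<delta> i) = q \<gamma> \<otimes>\<^bsub>?Q\<^esub> q \<delta>" if "\<gamma> \<in> \<Gamma>" "\<delta> \<in> \<Gamma>" for \<gamma> \<delta>
    using hom_mult[OF homq, of \<gamma> \<delta>] that unfolding mult\<Gamma> by simp
  have open\<tau>: "openin \<tau> D \<longleftrightarrow> D \<subseteq> carrier ?Q \<and>
      (\<forall>g\<in>D. \<exists>U\<in>unit_nbhds. \<forall>\<gamma>\<in>?star U. g \<otimes>\<^bsub>?Q\<^esub> q \<gamma> \<in> D)" for D
    unfolding \<tau>_def unit_nbhd_base.openin_group_topology[OF baseQ] by simp
  let ?f = "\<lambda>c. q (\<lambda>_. c)"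
  have f_hom: "?f \<in> hom G ?Q"
    by (rule homI) (use c\<Gamma> q_mult in \<open>auto simp: image_group_carrier\<close>)
  have f_inj: "inj_on ?f (carrier G)"
  proof (rule inj_onI)
    fix c d assume cd: "c \<in> carrier G" "d \<in> carrier G" "?f c = ?f d"
    then have "c \<otimes> inv d \<in> \<Inter>unit_nbhds"
      using q_eq[OF c\<Gamma> c\<Gamma>, of c d] F by (auto simp: eventually_const_iff)
    then have "c \<otimes> inv d = \<one>" using Inter_unit_nbhds by blast
    then show "c = d" using cd inv_solve_right' by fastforce
  qed
  have f_cont: "continuous_map T \<tau> ?f"
    unfolding continuous_map_def
  proof (intro conjI allI impI)
    show "?f \<in> topspace T \<rightarrow> topspace \<tau>"
      using f_hom Q.topspace_eq topspace_eq by (auto simp: hom_def)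
    fix D assume D: "openin \<tau> D"
    show "openin T {x \<in> topspace T. ?f x \<in> D}"
    proof (subst openin_subopen, rule ballI)
      fix x assume "x \<in> {x \<in> topspace T. ?f x \<in> D}"
      then have x: "x \<in> carrier G" "?f x \<in> D" using topspace_eq by auto
      then obtain U where U: "U \<in> unit_nbhds" "\<And>\<gamma>. \<gamma> \<in> ?star U \<Longrightarrow> ?f x \<otimes>\<^bsub>?Q\<^esub> q \<gamma> \<in> D"
        using D unfolding open\<tau> by blast
      have "?f y \<in> D" if y: "y \<in> carrier G" "inv x \<otimes> y \<in> U" for y
      proof -
        have "?f x \<otimes>\<^bsub>?Q\<^esub> ?f (inv x \<otimes> y) \<in> D"
          using x y c\<Gamma>[of "inv x \<otimes> y"] by (intro U) auto
        moreover have "?f x \<otimes>\<^bsub>?Q\<^esub> ?f (inv x \<otimes> y) = ?f (x \<otimes> (inv x \<otimes> y))"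
          using q_mult[OF c\<Gamma> c\<Gamma>, of x "inv x \<otimes> y"] x y by simp
        ultimately show ?thesis using x y by (simp add: m_assoc[symmetric])
      qed
      then show "\<exists>V. openin T V \<and> x \<in> V \<and> V \<subseteq> {x \<in> topspace T. ?f x \<in> D}"
        using openin_translates(1)[of U "inv x"] U(1) x topspace_eq
        by (intro exI[of _ "{y \<in> carrier G. inv x \<otimes> y \<in> U}"]) auto
    qed
  qed
  have closed_im: "closedin \<tau> (?f ` carrier G)"
    using closed f_hom f_inj f_cont Q.topological_group_axioms unfolding iTG_closed_def by blast
  have "q u \<in> ?f ` carrier G"
  proof (rule ccontr)
    assume "q u \<notin> ?f ` carrier G"
    define D where "D = topspace \<tau> - ?f ` carrier G"
    have "q u \<in> D"
      using \<open>q u \<notin> ?f ` carrier G\<close> u\<Gamma> Q.topspace_eq by (simp add: D_def image_group_carrier)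
    moreover have "openin \<tau> D"
      using closed_im by (simp add: closedin_def D_def)
    ultimately have "\<exists>U\<in>unit_nbhds. \<forall>\<gamma>\<in>?star U. q u \<otimes>\<^bsub>?Q\<^esub> q \<gamma> \<in> D"
      unfolding open\<tau> by (elim conjE bspec)
    then obtain U where U: "U \<in> unit_nbhds" and out: "\<forall>\<gamma>\<in>?star U. q u \<otimes>\<^bsub>?Q\<^esub> q \<gamma> \<in> D"
      by (elim bexE) (rule that)
    obtain V where V: "V \<in> unit_nbhds" "\<forall>x\<in>V. inv x \<in> U" using nbhd_inv[OF U] by blast
    obtain a where a: "a \<in> carrier G" "\<forall>\<^sub>F i in F. inv a \<otimes> u i \<in> V"
      using u V(1) unfolding cauchy_def by blast
    \<comment> \<open>the constant \<open>a\<close> differs from \<open>u\<close> by the small net \<open>u\<inverse> a\<close>, so its class is near that of \<open>u\<close>\<close>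
    have "\<forall>\<^sub>F i in F. inv (u i) \<otimes> a \<in> U"
      using a(2)
    proof eventually_elim
      case (elim i)
      then have "inv (inv a \<otimes> u i) \<in> U" using V by blast
      then show ?case using a uc by (simp add: inv_mult_group)
    qed
    moreover have g: "(\<lambda>i. inv (u i) \<otimes> a) \<in> \<Gamma>"
      using \<Gamma>.m_closed[of "inv\<^bsub>?G\<^esub> u" "\<lambda>_. a"] \<Gamma>.inv_closed[of u] u\<Gamma> c\<Gamma>[OF a(1)]
      unfolding mult\<Gamma> inv\<Gamma>[OF u\<Gamma>] by simp
    ultimately have "q u \<otimes>\<^bsub>?Q\<^esub> q (\<lambda>i. inv (u i) \<otimes> a) \<in> D" by (intro bspec[OF out]) simp
    moreover have "q u \<otimes>\<^bsub>?Q\<^esub> q (\<lambda>i. inv (u i) \<otimes> a) = ?f a"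
      using q_mult[OF u\<Gamma> g] uc a(1) by (simp add: m_assoc[symmetric])
    ultimately show False using a(1) by (simp add: D_def)
  qed
  then obtain x where x: "x \<in> carrier G" "q u = ?f x" by blast
  have "limitin T u x F"
    unfolding limitin_def
  proof (intro conjI allI impI)
    show "x \<in> topspace T" using x topspace_eq by simp
    fix D assume D: "openin T D \<and> x \<in> D"
    then have "{y \<in> carrier G. y \<otimes> x \<in> D} \<in> unit_nbhds"
      using x openin_translates(2) by auto
    then have "\<forall>\<^sub>F i in F. u i \<otimes> inv x \<in> {y \<in> carrier G. y \<otimes> x \<in> D}"
      using q_eq[OF u\<Gamma> c\<Gamma>[OF x(1)]] x(2) by blast
    then show "\<forall>\<^sub>F i in F. u i \<in> D"
      by eventually_elim (use uc x in \<open>simp add: m_assoc\<close>)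
  qed
  then show ?thesis ..
qed

end

section \<open>Compactness of closures of precompact sets\<close>

text \<open>Zorn's lemma applies because the infimum of a chain of proper filters is proper. A minimal
  proper filter \<open>M\<close> decides every \<open>P\<close>: if \<open>\<not> P\<close> does not hold eventually, then restricting \<open>M\<close> to \<open>P\<close>
  gives a proper filter, which by minimality is \<open>M\<close>.\<close>

lemma ex_ultrafilter_le:
  assumes F: "F \<noteq> bot"
  obtains M where "M \<le> F" "M \<noteq> bot" "\<And>P. eventually P M \<or> (\<forall>\<^sub>F x in M. \<not> P x)"
proof -
  let ?A = "{M. M \<le> F \<and> M \<noteq> bot}" and ?R = "\<lambda>M N :: 'a filter. N \<le> M"
  have "\<exists>M\<in>?A. \<forall>N\<in>?A. N \<le> M \<longrightarrow> N = M"
  proof (rule predicate_Zorn)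
    show "partial_order_on ?A (relation_of ?R ?A)"
      by (rule partial_order_on_relation_ofI) auto
    fix C assume C: "C \<in> Chains (relation_of ?R ?A)"
    then have CA: "C \<subseteq> ?A" by (auto simp: Chains_def relation_of_def)
    have chain: "M \<le> N \<or> N \<le> M" if "M \<in> C" "N \<in> C" for M N
      using C that by (auto simp: Chains_def relation_of_def)
    show "\<exists>U\<in>?A. \<forall>M\<in>C. U \<le> M"
    proof (cases "C = {}")
      case True
      then show ?thesis using F by auto
    next
      case False
      have base: "\<exists>L\<in>C. L \<le> inf M N" if "M \<in> C" "N \<in> C" for M N
        using chain[OF that] that by (auto intro: bexI[of _ M] bexI[of _ N])
      have "eventually P (Inf C) \<longleftrightarrow> (\<exists>M\<in>C. eventually P M)" for P
        by (rule eventually_Inf_base[OF False base])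
      then have "Inf C \<noteq> bot"
        using CA by (auto simp: trivial_limit_def)
      moreover have "Inf C \<le> F"
        using False CA by (auto intro: Inf_lower2)
      ultimately show ?thesis by (intro bexI[of _ "Inf C"]) (auto intro: Inf_lower)
    qed
  qed
  then obtain M where M: "M \<le> F" "M \<noteq> bot"
    and max: "\<And>N. \<lbrakk>N \<le> F; N \<noteq> bot; N \<le> M\<rbrakk> \<Longrightarrow> N = M" by blast
  have "eventually P M \<or> (\<forall>\<^sub>F x in M. \<not> P x)" for P
  proof (rule disjCI)
    assume "\<not> (\<forall>\<^sub>F x in M. \<not> P x)"
    then have "inf M (principal {x. P x}) \<noteq> bot"
      by (simp add: trivial_limit_def eventually_inf_principal)
    then have "inf M (principal {x. P x}) = M"
      using M(1) by (intro max) (auto intro: le_infI1)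
    then have "eventually P (inf M (principal {x. P x})) = eventually P M" by simp
    then show "eventually P M" by (simp add: eventually_inf_principal)
  qed
  with M show thesis by (rule that)
qed

text \<open>A family of closed sets with the finite intersection property generates a proper filter; the
  limit of any finer ultrafilter lies in all members of the family.\<close>

lemma compactin_ultrafilters:
  assumes K: "closedin T K"
    and lim: "\<And>M. \<lbrakk>M \<noteq> bot; \<And>P. eventually P M \<or> (\<forall>\<^sub>F x in M. \<not> P x); \<forall>\<^sub>F x in M. x \<in> K\<rbrakk>
                \<Longrightarrow> \<exists>l. limitin T (\<lambda>x. x) l M"
  shows "compactin T K"
  unfolding compactin_fip
proof (intro conjI allI impI; (elim conjE)?)
  show "K \<subseteq> topspace T" using K by (rule closedin_subset)
  fix \<U> assume closed: "\<forall>C\<in>\<U>. closedin T C"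
    and fip: "\<forall>\<F>. finite \<F> \<and> \<F> \<subseteq> \<U> \<longrightarrow> K \<inter> \<Inter>\<F> \<noteq> {}"
  have "(INF C\<in>insert K \<U>. principal C) \<noteq> bot"
  proof (rule INF_filter_not_bot)
    fix \<F> assume \<F>: "\<F> \<subseteq> insert K \<U>" "finite \<F>"
    then have "K \<inter> \<Inter>(\<F> - {K}) \<noteq> {}" by (intro fip[rule_format]) auto
    moreover have "K \<inter> \<Inter>(\<F> - {K}) \<subseteq> \<Inter>\<F>" by auto
    ultimately show "(INF C\<in>\<F>. principal C) \<noteq> bot"
      using INF_principal_finite[OF \<F>(2), of "\<lambda>C. C"] by (auto simp: principal_eq_bot_iff)
  qed
  then obtain M where M: "M \<le> (INF C\<in>insert K \<U>. principal C)" "M \<noteq> bot"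
    "\<And>P. eventually P M \<or> (\<forall>\<^sub>F x in M. \<not> P x)"
    by (rule ex_ultrafilter_le) (rule that)
  have ev: "\<forall>\<^sub>F x in M. x \<in> C" if "C \<in> insert K \<U>" for C
  proof -
    have "M \<le> principal C" using M(1) that by (meson INF_lower order_trans)
    then show ?thesis by (simp add: le_principal)
  qed
  obtain l where l: "limitin T (\<lambda>x. x) l M"
    using lim[OF M(2,3)] ev by blast
  have "l \<in> C" if "C \<in> insert K \<U>" for C
    using limitin_closedin[OF l _ ev[OF that] M(2)] closed K that by blast
  then show "K \<inter> \<Inter>\<U> \<noteq> {}" by blast
qed

context topological_group
begin

text \<open>A point \<open>x\<close> of the closure has some \<open>a \<in> A\<close> with \<open>a\<inverse>x\<close> small, and \<open>A \<subseteq> FV\<close> then gives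
  \<open>x = a (a\<inverse>x) \<in> FVV\<close>.\<close>

lemma precompact_in_closure_of:
  assumes A: "precompact_in G T A" "A \<subseteq> carrier G"
  shows "precompact_in G T (T closure_of A)"
  unfolding precompact_in_def
proof (intro allI impI)
  fix U assume U: "U \<subseteq> carrier G" "\<one> \<in> T interior_of U"
  then have "T interior_of U \<in> unit_nbhds" by simp
  then obtain V where V: "V \<in> unit_nbhds" "\<forall>x\<in>V. \<forall>y\<in>V. x \<otimes> y \<in> T interior_of U"
    using nbhd_mult by meson
  obtain W where W: "W \<in> unit_nbhds" "\<forall>x\<in>W. inv x \<in> V" using nbhd_inv[OF V(1)] by meson
  have Vc: "V \<subseteq> carrier G" using nbhd_subset[OF V(1)] .
  have VU: "x \<otimes> y \<in> U" if "x \<in> V" "y \<in> V" for x y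
    using V that interior_of_subset[of T U] by blast
  have "\<one> \<in> T interior_of V" using V(1) by (simp add: interior_of_openin)
  then obtain F where F: "F \<subseteq> carrier G" "finite F" "A \<subseteq> (F <#> V) \<inter> (V <#> F)"
    using A(1) Vc unfolding precompact_in_def by meson
  have "x \<in> F <#> U \<and> x \<in> U <#> F" if x: "x \<in> T closure_of A" for x
  proof
    have xc: "x \<in> carrier G" using x topspace_eq closure_of_subset_topspace by fastforce
    have meets: "\<exists>a\<in>A. a \<in> D" if "openin T D" "x \<in> D" for D
      using x that by (auto simp: in_closure_of)
    show "x \<in> F <#> U"
    proof -
      have "openin T {y \<in> carrier G. inv x \<otimes> y \<in> W}"
        using W(1) xc by (intro openin_translates) auto
      then obtain a where a: "a \<in> A" "inv x \<otimes> a \<in> W"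
        using meets[of "{y \<in> carrier G. inv x \<otimes> y \<in> W}"] W(1) xc by auto
      obtain g v where gv: "g \<in> F" "v \<in> V" "a = g \<otimes> v"
        using F(3) a(1) by (auto simp: set_mult_def)
      have c: "g \<in> carrier G" "v \<in> carrier G" "a \<in> carrier G" using gv F Vc a A by auto
      have "inv (inv x \<otimes> a) \<in> V" using W a by blast
      then have "v \<otimes> (inv a \<otimes> x) \<in> U" using gv xc c by (intro VU) (simp_all add: inv_mult_group)
      moreover have "g \<otimes> (v \<otimes> (inv a \<otimes> x)) = x"
        using c(1,2) xc unfolding gv(3) by (simp add: inv_mult_group m_assoc[symmetric])
      ultimately show ?thesis using gv(1) by (force simp: set_mult_def)
    qed
    show "x \<in> U <#> F"
    proof -
      have "openin T {y \<in> carrier G. y \<otimes> inv x \<in> W}"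
        using W(1) xc by (intro openin_translates) auto
      then obtain a where a: "a \<in> A" "a \<otimes> inv x \<in> W"
        using meets[of "{y \<in> carrier G. y \<otimes> inv x \<in> W}"] W(1) xc by auto
      obtain g v where gv: "g \<in> F" "v \<in> V" "a = v \<otimes> g"
        using F(3) a(1) by (auto simp: set_mult_def)
      have c: "g \<in> carrier G" "v \<in> carrier G" "a \<in> carrier G" using gv F Vc a A by auto
      have "inv (a \<otimes> inv x) \<in> V" using W a by blast
      then have "(x \<otimes> inv a) \<otimes> v \<in> U" using gv xc c by (intro VU) (simp_all add: inv_mult_group)
      moreover have "(x \<otimes> inv a) \<otimes> v \<otimes> g = x"
        using c(1,2) xc unfolding gv(3) by (simp add: inv_mult_group m_assoc)
      ultimately show ?thesis using gv(1) by (force simp: set_mult_def)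
    qed
  qed
  then show "\<exists>F\<subseteq>carrier G. finite F \<and> T closure_of A \<subseteq> (F <#> U) \<inter> (U <#> F)"
    using F by (intro exI[of _ F]) blast
qed

text \<open>Finitely many translates \<open>aU\<close> cover \<open>K\<close>, so an ultrafilter on \<open>K\<close> contains one of them, and
  likewise one of the translates \<open>Ub\<close>. The value \<open>\<one>\<close> outside the carrier is there because a Cauchy net
  takes all of its values in the group; the ultrafilter does not see it.\<close>

lemma cauchy_ultrafilter:
  assumes K: "precompact_in G T K" "K \<subseteq> carrier G"
    and M: "M \<noteq> bot" "\<And>P. eventually P M \<or> (\<forall>\<^sub>F x in M. \<not> P x)" "\<forall>\<^sub>F x in M. x \<in> K"
  shows "cauchy M (\<lambda>x. if x \<in> carrier G then x else \<one>)"
  unfolding cauchy_def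
proof (intro conjI ballI allI)
  show "(if x \<in> carrier G then x else \<one>) \<in> carrier G" for x by simp
  fix U assume U: "U \<in> unit_nbhds"
  then have Uc: "U \<subseteq> carrier G" by (rule nbhd_subset)
  have "\<one> \<in> T interior_of U" using U by (simp add: interior_of_openin)
  then obtain F where F: "F \<subseteq> carrier G" "finite F" "K \<subseteq> (F <#> U) \<inter> (U <#> F)"
    using K(1) Uc unfolding precompact_in_def by meson
  have pigeonhole: "\<exists>a\<in>F. \<forall>\<^sub>F x in M. P a x" if P: "\<And>x. x \<in> K \<Longrightarrow> \<exists>a\<in>F. P a x" for P
  proof (rule ccontr)
    assume "\<not> (\<exists>a\<in>F. \<forall>\<^sub>F x in M. P a x)"
    then have "\<forall>a\<in>F. \<forall>\<^sub>F x in M. \<not> P a x" using M(2) by blast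
    then have "\<forall>\<^sub>F x in M. \<forall>a\<in>F. \<not> P a x" using F(2) by (intro eventually_ball_finite)
    then have "\<forall>\<^sub>F x in M. False" using M(3) by eventually_elim (use P in blast)
    then show False using M(1) by (simp add: trivial_limit_def)
  qed
  have "\<exists>a\<in>F. inv a \<otimes> x \<in> U" if x: "x \<in> K" for x
  proof -
    obtain a v where "a \<in> F" "v \<in> U" "x = a \<otimes> v" using F(3) x by (auto simp: set_mult_def)
    moreover from this have "inv a \<otimes> x = v" using F Uc by (auto simp: m_assoc[symmetric] subset_iff)
    ultimately show ?thesis by (metis (no_types))
  qed
  then obtain a where a: "a \<in> F" "\<forall>\<^sub>F x in M. inv a \<otimes> x \<in> U"
    using pigeonhole[of "\<lambda>a x. inv a \<otimes> x \<in> U"] by blast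
  have "\<forall>\<^sub>F x in M. inv a \<otimes> (if x \<in> carrier G then x else \<one>) \<in> U"
    using a(2) M(3) by eventually_elim (use K in auto)
  then show "\<exists>a\<in>carrier G. \<forall>\<^sub>F x in M. inv a \<otimes> (if x \<in> carrier G then x else \<one>) \<in> U"
    using a F by blast
  have "\<exists>b\<in>F. x \<otimes> inv b \<in> U" if x: "x \<in> K" for x
  proof -
    obtain b v where "b \<in> F" "v \<in> U" "x = v \<otimes> b" using F(3) x by (auto simp: set_mult_def)
    moreover from this have "x \<otimes> inv b = v" using F Uc by (auto simp: m_assoc subset_iff)
    ultimately show ?thesis by (metis (no_types))
  qed
  then obtain b where b: "b \<in> F" "\<forall>\<^sub>F x in M. x \<otimes> inv b \<in> U"
    using pigeonhole[of "\<lambda>b x. x \<otimes> inv b \<in> U"] by blast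
  have "\<forall>\<^sub>F x in M. (if x \<in> carrier G then x else \<one>) \<otimes> inv b \<in> U"
    using b(2) M(3) by eventually_elim (use K in auto)
  then show "\<exists>b\<in>carrier G. \<forall>\<^sub>F x in M. (if x \<in> carrier G then x else \<one>) \<otimes> inv b \<in> U"
    using b F by blast
qed

lemma compactin_closure_of_precompact:
  assumes closed: "iTG_closed TYPE('b) G T"
    and inf: "infinite (carrier G)" and card: "carrier G \<lesssim> (UNIV :: 'b set)"
    and A: "precompact_in G T A" "A \<subseteq> carrier G"
  shows "compactin T (T closure_of A)"
proof (rule compactin_ultrafilters)
  show "closedin T (T closure_of A)" by simp
  have Kc: "T closure_of A \<subseteq> carrier G" using topspace_eq closure_of_subset_topspace by fastforce
  fix M assume M: "M \<noteq> bot" "\<And>P. eventually P M \<or> (\<forall>\<^sub>F x in M. \<not> P x)"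
    "\<forall>\<^sub>F x in M. x \<in> T closure_of A"
  have "cauchy M (\<lambda>x. if x \<in> carrier G then x else \<one>)"
    by (rule cauchy_ultrafilter[OF precompact_in_closure_of[OF A] Kc M])
  then obtain l where l: "limitin T (\<lambda>x. if x \<in> carrier G then x else \<one>) l M"
    using Cauchy_net_converges[OF closed inf card M(1)] by blast
  have "limitin T (\<lambda>x. x) l M"
    by (rule limitin_transform_eventually[OF _ l])
      (use M(3) Kc in \<open>auto elim: eventually_mono\<close>)
  then show "\<exists>l. limitin T (\<lambda>x. x) l M" ..
qed


section \<open>Images in topological semigroups\<close>

text \<open>The closure \<open>Z\<close> of the image is a submonoid whose unit is the image of the unit. The set of
  \<open>y\<close> with \<open>y\<^sup>n \<in> f(K)\<close> is closed, because \<open>f(K)\<close> is compact, so it contains \<open>Z\<close>. On the compact set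
  \<open>K\<close> the map \<open>f\<close> is a homeomorphism onto its image, which makes the transported inversion
  \<open>j : f(K) \<rightarrow> Z\<close> continuous, although \<open>f\<close> need not be a homeomorphism on all of \<open>G\<close>. Therefore
  \<open>y \<mapsto> j(y\<^sup>n) y\<^sup>n\<^sup>-\<^sup>1\<close> is a continuous inversion on \<open>Z\<close>, and \<open>Z\<close> is a topological group, in which the
  image of \<open>G\<close> is closed by assumption.\<close>

lemma closed_image_if_powers_in_compact:
  fixes Y :: "'b monoid" and n :: nat
  assumes closed: "iTG_closed TYPE('b) G T"
    and K: "compactin T K" and n: "n \<ge> 1" and pow: "\<And>x. x \<in> carrier G \<Longrightarrow> x [^] n \<in> K"
    and Y: "topological_semigroup Y S" and f: "f \<in> hom G Y" "inj_on f (carrier G)"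
    and cont: "continuous_map T S f"
  shows "closedin S (f ` carrier G)"
proof -
  interpret Y: topological_semigroup Y S by (rule Y)
  let ?X = "f ` carrier G"
  define Z where "Z = S closure_of ?X"
  define H where "H = Y\<lparr>carrier := Z, one := f \<one>\<rparr>"
  have XS: "?X \<subseteq> topspace S" using f(1) Y.topspace_eq by (auto simp: hom_def)
  have XZ: "?X \<subseteq> Z" unfolding Z_def by (rule closure_of_subset[OF XS])
  have ZY: "Z \<subseteq> carrier Y" unfolding Z_def using closure_of_subset_topspace Y.topspace_eq by metis
  have f_mult: "f (x \<otimes> y) = f x \<otimes>\<^bsub>Y\<^esub> f y" if "x \<in> carrier G" "y \<in> carrier G" for x y
    using f(1) that by (rule hom_mult)
  have fZ: "f x \<in> Z" if "x \<in> carrier G" for x using XZ that by blast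
  have fY: "f x \<in> carrier Y" if "x \<in> carrier G" for x using fZ ZY that by blast
  have Z_mult: "x \<otimes>\<^bsub>Y\<^esub> y \<in> Z" if "x \<in> Z" "y \<in> Z" for x y
  proof -
    have "(\<lambda>(x, y). x \<otimes>\<^bsub>Y\<^esub> y) ` (prod_topology S S closure_of (?X \<times> ?X)) \<subseteq>
        S closure_of ((\<lambda>(x, y). x \<otimes>\<^bsub>Y\<^esub> y) ` (?X \<times> ?X))"
      by (rule continuous_map_image_closure_subset[OF Y.continuous_mult])
    also have "\<dots> \<subseteq> Z"
      unfolding Z_def by (intro closure_of_mono) (auto simp flip: f_mult)
    finally show ?thesis using that by (auto simp: closure_of_Times Z_def)
  qed
  have l_unit: "f \<one> \<otimes>\<^bsub>Y\<^esub> y = y" and r_unit: "y \<otimes>\<^bsub>Y\<^esub> f \<one> = y" if "y \<in> Z" for y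
  proof -
    have c: "continuous_map S S (\<lambda>y. f \<one> \<otimes>\<^bsub>Y\<^esub> y)" "continuous_map S S (\<lambda>y. y \<otimes>\<^bsub>Y\<^esub> f \<one>)"
      using fY Y.topspace_eq by (intro continuous_map_pointwise_mult[OF Y.continuous_mult]; simp)+
    have u: "f \<one> \<otimes>\<^bsub>Y\<^esub> x = x" "x \<otimes>\<^bsub>Y\<^esub> f \<one> = x" if "x \<in> ?X" for x
      using that by (auto simp flip: f_mult)
    show "f \<one> \<otimes>\<^bsub>Y\<^esub> y = y" "y \<otimes>\<^bsub>Y\<^esub> f \<one> = y"
      using forall_in_closure_of_eq[OF \<open>y \<in> Z\<close>[unfolded Z_def] Y.Hausdorff c(1) continuous_map_id[unfolded id_def] u(1)]
        forall_in_closure_of_eq[OF \<open>y \<in> Z\<close>[unfolded Z_def] Y.Hausdorff c(2) continuous_map_id[unfolded id_def] u(2)]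
      by auto
  qed
  have H_simps: "carrier H = Z" "\<one>\<^bsub>H\<^esub> = f \<one>" "\<And>x y. x \<otimes>\<^bsub>H\<^esub> y = x \<otimes>\<^bsub>Y\<^esub> y"
    by (simp_all add: H_def)
  interpret H: monoid H
    using Z_mult fZ[OF one_closed] l_unit r_unit Y.m_assoc ZY
    by (intro monoidI) (auto simp: H_simps subset_iff)
  have pow_f: "f x [^]\<^bsub>H\<^esub> k = f (x [^] k)" if "x \<in> carrier G" for x and k :: nat
    by (induction k) (use that in \<open>simp_all add: H_simps f_mult\<close>)
  have pow_cont: "continuous_map S S (\<lambda>y. y [^]\<^bsub>H\<^esub> k)" for k :: nat
  proof (induction k)
    case 0
    then show ?case using fY[OF one_closed] Y.topspace_eq by (simp add: H_simps)
  next
    case (Suc k)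
    then show ?case
      using continuous_map_pointwise_mult[OF Y.continuous_mult Suc continuous_map_id[unfolded id_def]]
      by (simp add: H_simps)
  qed
  have KG: "K \<subseteq> carrier G" using compactin_subset_topspace[OF K] topspace_eq by simp
  have fK: "compactin S (f ` K)" by (rule image_compactin[OF K cont])
  have pow_in: "y [^]\<^bsub>H\<^esub> n \<in> f ` K" if "y \<in> Z" for y
  proof -
    have "closedin S {y \<in> topspace S. y [^]\<^bsub>H\<^esub> n \<in> f ` K}"
      by (rule closedin_continuous_map_preimage[OF pow_cont compactin_imp_closedin[OF Y.Hausdorff fK]])
    moreover have "?X \<subseteq> {y \<in> topspace S. y [^]\<^bsub>H\<^esub> n \<in> f ` K}"
      using XS pow by (auto simp: pow_f)
    ultimately show ?thesis using that closure_of_minimal unfolding Z_def by blast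
  qed
  define j where "j y = f (inv (inv_into K f y))" for y
  have j_f: "j (f k) = f (inv k)" if "k \<in> K" for k
    using that inv_into_f_f[OF inj_on_subset[OF f(2) KG]] by (simp add: j_def)
  have j_cont: "continuous_map (subtopology S (f ` K)) S j"
  proof (rule continuous_compose_quotient_map)
    show "quotient_map (subtopology T K) (subtopology S (f ` K)) f"
    proof (rule continuous_imp_quotient_map)
      show "continuous_map (subtopology T K) (subtopology S (f ` K)) f"
        using cont by (simp add: continuous_map_in_subtopology continuous_map_from_subtopology)
      show "compact_space (subtopology T K)" by (rule compact_space_subtopology[OF K])
      show "Hausdorff_space (subtopology S (f ` K))" by (rule Hausdorff_space_subtopology[OF Y.Hausdorff])
      show "f ` topspace (subtopology T K) = topspace (subtopology S (f ` K))"
        using KG XS topspace_eq by auto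
    qed
    have "continuous_map (subtopology T K) S (f \<circ> (\<lambda>x. inv x))"
      by (intro continuous_map_from_subtopology continuous_map_compose[OF continuous_inv cont])
    then show "continuous_map (subtopology T K) S (j \<circ> f)"
      by (rule continuous_map_eq) (simp add: j_f)
  qed
  define I where "I y = j (y [^]\<^bsub>H\<^esub> n) \<otimes>\<^bsub>Y\<^esub> y [^]\<^bsub>H\<^esub> (n - 1)" for y
  have I: "I y \<in> Z" "I y \<otimes>\<^bsub>Y\<^esub> y = f \<one>" if y: "y \<in> Z" for y
  proof -
    obtain k where k: "k \<in> K" "y [^]\<^bsub>H\<^esub> n = f k" using pow_in[OF y] by blast
    have p: "y [^]\<^bsub>H\<^esub> m \<in> Z" for m :: nat using H.nat_pow_closed[of y m] y by (simp add: H_simps)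
    have kG: "k \<in> carrier G" using k KG by blast
    show "I y \<in> Z" unfolding I_def k(2) j_f[OF k(1)] using kG fZ p by (intro Z_mult) auto
    have "I y \<otimes>\<^bsub>Y\<^esub> y = f (inv k) \<otimes>\<^bsub>Y\<^esub> (y [^]\<^bsub>H\<^esub> (n - 1) \<otimes>\<^bsub>Y\<^esub> y)"
      unfolding I_def k(2) j_f[OF k(1)] using kG fY p ZY y by (intro Y.m_assoc) auto
    also have "y [^]\<^bsub>H\<^esub> (n - 1) \<otimes>\<^bsub>Y\<^esub> y = y [^]\<^bsub>H\<^esub> n"
      using n H.nat_pow_Suc[of y "n - 1"] by (simp add: H_simps)
    finally show "I y \<otimes>\<^bsub>Y\<^esub> y = f \<one>" using k(2) kG by (simp flip: f_mult)
  qed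
  have group_H: "group H"
    by (rule H.group_l_invI) (use I in \<open>auto simp: H_simps\<close>)
  have inv_H: "inv\<^bsub>H\<^esub> y = I y" if "y \<in> Z" for y
    by (rule group.inv_equality[OF group_H]) (use I that in \<open>auto simp: H_simps\<close>)
  have top_H: "topological_group H (subtopology S Z)"
  proof (rule topological_group.intro[OF group_H], unfold_locales)
    show "topspace (subtopology S Z) = carrier H" using ZY Y.topspace_eq by (auto simp: H_simps)
    show "Hausdorff_space (subtopology S Z)" by (rule Hausdorff_space_subtopology[OF Y.Hausdorff])
    show "continuous_map (prod_topology (subtopology S Z) (subtopology S Z)) (subtopology S Z)
            (\<lambda>(x, y). x \<otimes>\<^bsub>H\<^esub> y)"
      using Y.continuous_mult Z_mult
      by (auto simp: H_simps continuous_map_in_subtopology subtopology_Times[symmetric]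
          intro: continuous_map_from_subtopology)
    have I_cont: "continuous_map (subtopology S Z) S I"
      unfolding I_def
    proof (rule continuous_map_pointwise_mult[OF Y.continuous_mult])
      have "continuous_map (subtopology S Z) (subtopology S (f ` K)) (\<lambda>y. y [^]\<^bsub>H\<^esub> n)"
        using pow_cont pow_in by (auto simp: continuous_map_in_subtopology intro: continuous_map_from_subtopology)
      then show "continuous_map (subtopology S Z) S (\<lambda>y. j (y [^]\<^bsub>H\<^esub> n))"
        using continuous_map_compose[OF _ j_cont] by (simp add: o_def)
      show "continuous_map (subtopology S Z) S (\<lambda>y. y [^]\<^bsub>H\<^esub> (n - 1))"
        using pow_cont by (rule continuous_map_from_subtopology)
    qed
    then have "continuous_map (subtopology S Z) (subtopology S Z) I"
      using I(1) by (auto simp: continuous_map_in_subtopology)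
    then show "continuous_map (subtopology S Z) (subtopology S Z) (\<lambda>x. inv\<^bsub>H\<^esub> x)"
      by (rule continuous_map_eq) (simp add: inv_H)
  qed
  have "f \<in> hom G H"
    by (rule homI) (auto simp: H_simps fZ f_mult)
  moreover have "continuous_map T (subtopology S Z) f"
    using cont fZ topspace_eq by (auto simp: continuous_map_in_subtopology)
  ultimately have "closedin (subtopology S Z) ?X"
    using closed f(2) top_H unfolding iTG_closed_def by blast
  then show ?thesis
    using closedin_trans_full[of S Z] by (simp add: Z_def)
qed

end

lemma topological_group_imp_semigroup:
  assumes "topological_group G T"
  shows "topological_semigroup G T"
proof -
  interpret topological_group G T by fact
  show ?thesis
    using topspace_eq Hausdorff continuous_mult by unfold_locales (auto simp: m_assoc)
qed

theorem theorem5p1: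
  fixes X :: "('a, 'm) monoid_scheme" and T :: "'a topology"
  assumes "topological_group X T"
    and "precompact_exponent X T"
  shows "iTS_closed TYPE('b) X T \<longleftrightarrow> iTG_closed TYPE('b) X T"
proof
  assume "iTS_closed TYPE('b) X T"
  then show "iTG_closed TYPE('b) X T"
    unfolding iTS_closed_def iTG_closed_def using topological_group_imp_semigroup by blast
next
  assume closed: "iTG_closed TYPE('b) X T"
  interpret X: topological_group X T by fact
  obtain n :: nat where n: "n \<ge> 1" and pre: "precompact_in X T ((\<lambda>x. x [^]\<^bsub>X\<^esub> n) ` carrier X)"
    using assms(2) by (auto simp: precompact_exponent_def)
  show "iTS_closed TYPE('b) X T"
    unfolding iTS_closed_def
  proof (intro allI impI; elim conjE)
    fix Y :: "'b monoid" and S f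
    assume Y: "topological_semigroup Y S" and f: "f \<in> hom X Y" "inj_on f (carrier X)"
      and cont: "continuous_map T S f"
    let ?A = "(\<lambda>x. x [^]\<^bsub>X\<^esub> n) ` carrier X"
    have A: "?A \<subseteq> carrier X" by auto
    \<comment> \<open>the bound on the size of the extension by a limit is for infinite groups; a finite image is
      closed for a simpler reason\<close>
    show "closedin S (f ` carrier X)"
    proof (cases "finite (carrier X)")
      case True
      have "f ` carrier X \<subseteq> topspace S"
        using f(1) topological_semigroup.topspace_eq[OF Y] by (auto simp: hom_def)
      then show ?thesis
        using True topological_semigroup.Hausdorff[OF Y] by (intro closedin_Hausdorff_finite) auto
    next
      case False
      have "carrier X \<lesssim> (UNIV :: 'b set)" using f(2) by (auto simp: lepoll_def)
      then have "compactin T (T closure_of ?A)"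
        by (rule X.compactin_closure_of_precompact[OF closed False _ pre A])
      moreover have "x [^]\<^bsub>X\<^esub> n \<in> T closure_of ?A" if "x \<in> carrier X" for x
        using closure_of_subset[of ?A T] A X.topspace_eq that by auto
      ultimately show ?thesis
        using X.closed_image_if_powers_in_compact[OF closed _ n _ Y f cont] by blast
    qed
  qed
qed

end
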